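(* Let $G$ be a non-locally compact GO-space which is rectifiable, let $bG$ be a Hausdorff compactification of $G$, and let $Y=bG\setminus G$. If $Y$ has locally a quasi-$G_\delta$-diagonal, then $G$, $Y$ and $bG$ are separable and metrizable.
   Context: All spaces are Tychonoff. A topological space $G$ is rectifiable if there are an element $e\in G$ and a surjective homeomorphism $\varphi:G\times G\to G\times G$ such that $\pi_1\circ\varphi=\pi_1$ and $\varphi(x,x)=(x,e)$ for every $x\in G$, where $\pi_1:G\times G\to G$ is the projection to the first coordinate. A LOTS is a linearly ordered set with its open-interval topology. A GO-space (suborderable space) is a topological space homeomorphic to a subspace of a LOTS. A space is locally compact if every point has a compact neighborhood. A space $X$ has a quasi-$G_\delta$-diagonal if there is a sequence $\{\mathcal{G}(n):n\in\mathbb{N}\}$ of collections of open sets of $X$ such that, for any distinct $x,y\in X$, there is some $n$ with $x\in \mathrm{st}(x,\mathcal{G}(n))\subset X\setminus\{y\}$, where $\mathrm{st}(x,\mathcal{G}(n))=\bigcup\{U\in\mathcal{G}(n):x\in U\}$. A space has a property locally if every point has a neighborhood with that property. *)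

theory Defs
  imports "HOL-Analysis.Analysis"
begin

(* completely_regular_space does not include any separation of points. *)
definition Tychonoff_space :: "'a topology \<Rightarrow> bool" where
  "Tychonoff_space X \<longleftrightarrow> completely_regular_space X \<and> Hausdorff_space X"

definition rectifiable_space :: "'a topology \<Rightarrow> bool" where
  "rectifiable_space G \<longleftrightarrow>
     (\<exists>e \<in> topspace G. \<exists>\<phi>.
        homeomorphic_map (prod_topology G G) (prod_topology G G) \<phi> \<and>
        (\<forall>p \<in> topspace (prod_topology G G). fst (\<phi> p) = fst p) \<and>
        (\<forall>x \<in> topspace G. \<phi> (x, x) = (x, e)))"

(* HOL cannot quantify existentially over types, so the type 'c of points of the ambient LOTS
   is an explicit argument. A hypothesis GO_space TYPE('c) X with 'c a type variable of the
   theorem covers every LOTS. The type class linorder_topology says precisely that the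
   topology is the open-interval topology of the linear order. *)
definition GO_space :: "'c::linorder_topology itself \<Rightarrow> 'a topology \<Rightarrow> bool" where
  "GO_space _ X \<longleftrightarrow> (\<exists>S :: 'c set. X homeomorphic_space top_of_set S)"

(* bG is a Hausdorff compactification of G, where i identifies G with a dense subspace of bG. *)
definition Hausdorff_compactification ::
    "'a topology \<Rightarrow> 'b topology \<Rightarrow> ('a \<Rightarrow> 'b) \<Rightarrow> bool" where
  "Hausdorff_compactification G bG i \<longleftrightarrow>
     compact_space bG \<and> Hausdorff_space bG \<and> embedding_map G bG i \<and>
     bG closure_of (i ` topspace G) = topspace bG"

definition star :: "'a \<Rightarrow> 'a set set \<Rightarrow> 'a set" where
  "star x \<U> = \<Union>{U \<in> \<U>. x \<in> U}"

(* The condition x \<in> star x (\<G> n) is not automatic, as \<G> n need not cover the space. *)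
definition quasi_G_delta_diagonal :: "'a topology \<Rightarrow> bool" where
  "quasi_G_delta_diagonal X \<longleftrightarrow>
     (\<exists>\<G> :: nat \<Rightarrow> 'a set set.
        (\<forall>n. \<forall>U \<in> \<G> n. openin X U) \<and>
        (\<forall>x \<in> topspace X. \<forall>y \<in> topspace X. x \<noteq> y \<longrightarrow>
           (\<exists>n. x \<in> star x (\<G> n) \<and> star x (\<G> n) \<subseteq> topspace X - {y})))"

(* Only one neighbourhood of each point is required to have the property, not a
   neighbourhood base, so this differs from neighbourhood_base_of. *)
definition has_locally :: "('a topology \<Rightarrow> bool) \<Rightarrow> 'a topology \<Rightarrow> bool" where
  "has_locally P X \<longleftrightarrow>
     (\<forall>x \<in> topspace X. \<exists>U V. openin X U \<and> x \<in> U \<and> U \<subseteq> V \<and> V \<subseteq> topspace X \<and>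
        P (subtopology X V))"

end

theory Submission
  imports Defs
begin

text \<open>
Since \<open>G\<close> is homogeneous and not locally compact, it contains no nonempty open set of \<open>bG\<close>; hence
both \<open>G\<close> and the remainder \<open>Y\<close> are dense in \<open>bG\<close>. The argument then has three stages.

First, \<open>G\<close> is first countable. Every point of a GO-space has a countable \<open>\<pi>\<close>-base or is a
P-point. If every point were a P-point, no countable subset of \<open>Y\<close> could accumulate at a point of
\<open>G\<close>, so closed neighbourhoods in \<open>Y\<close> would be countably compact. Small ones have a
quasi-\<open>G\<^sub>\<delta>\<close>-diagonal, and a countably compact space with such a diagonal is compact
(\<open>countably_compact_quasi_G_delta_diagonal_imp_compact\<close>); but a compact neighbourhood in \<open>Y\<close>
contradicts the density of \<open>G\<close>. So some point has a countable \<open>\<pi>\<close>-base, and a rectification turns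
it into a countable base at the unit.

Second, \<open>G\<close> is second countable. Closed discrete subsets of \<open>G\<close> expand to locally finite families of open
sets, because \<open>G\<close> is suborderable. Such a family accumulates in \<open>bG\<close> only on a compact subset \<open>F\<close> of
\<open>Y\<close>. Compact spaces with a quasi-\<open>G\<^sub>\<delta>\<close>-diagonal are metrizable
(\<open>compact_quasi_G_delta_diagonal_imp_second_countable_metrizable\<close>), which makes \<open>F\<close> a
\<open>G\<^sub>\<delta>\<close>-set of \<open>Y\<close> and thereby forces the family to be countable. For a first countable rectifiable
space, countability of all closed discrete subsets yields a countable dense set and then a countable base.

Third, a countable base of \<open>G\<close> makes \<open>Y\<close> Lindelof, so that countably many of the local diagonal
families suffice for all of \<open>Y\<close>; together with the base of \<open>G\<close> they give \<open>bG\<close> itself a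
quasi-\<open>G\<^sub>\<delta>\<close>-diagonal. As \<open>bG\<close> is compact, it is metrizable, and all three spaces are
subspaces of a compact metrizable space.
\<close>

section \<open>Quasi-\<open>G\<^sub>\<delta>\<close>-diagonals\<close>

lemma has_locally_neighbourhood:
  assumes "has_locally P X" "x \<in> topspace X"
  obtains U V where "openin X U" "x \<in> U" "U \<subseteq> V" "V \<subseteq> topspace X" "P (subtopology X V)"
proof -
  have "\<exists>U V. openin X U \<and> x \<in> U \<and> U \<subseteq> V \<and> V \<subseteq> topspace X \<and> P (subtopology X V)"
    using assms by (simp add: has_locally_def)
  then show thesis using that by (elim exE conjE)
qed

text \<open>
Only the countability of the system of families matters. Allowing any countable index set lets
systems be merged without re-enumerating them; the default family \<open>{}\<close> below keeps the
enumeration possible when the system is empty.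
\<close>

lemma quasi_G_delta_diagonal_countable_families:
  assumes "countable \<AA>" "\<And>\<G> U. \<lbrakk>\<G> \<in> \<AA>; U \<in> \<G>\<rbrakk> \<Longrightarrow> openin X U"
    and "\<And>x y. \<lbrakk>x \<in> topspace X; y \<in> topspace X; x \<noteq> y\<rbrakk> \<Longrightarrow> \<exists>\<G>\<in>\<AA>. x \<in> star x \<G> \<and> y \<notin> star x \<G>"
  shows "quasi_G_delta_diagonal X"
proof -
  have "countable (insert {} \<AA>)" using assms(1) by simp
  then obtain \<G> :: "nat \<Rightarrow> 'a set set" where \<G>: "range \<G> = insert {} \<AA>"
    using uncountable_def[of "insert {} \<AA>"] by auto
  have op: "openin X U" if U: "U \<in> \<G> n" for n U
  proof -
    have "\<G> n \<in> insert {} \<AA>" using \<G> by blast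
    then show ?thesis using assms(2) U by blast
  qed
  show ?thesis
    unfolding quasi_G_delta_diagonal_def
  proof (intro exI[of _ \<G>] conjI allI ballI impI)
    show "openin X U" if "U \<in> \<G> n" for n U by (rule op[OF that])
    fix x y assume xy: "x \<in> topspace X" "y \<in> topspace X" "x \<noteq> y"
    then obtain \<H> where \<H>: "\<H> \<in> \<AA>" "x \<in> star x \<H>" "y \<notin> star x \<H>" using assms(3)[OF xy] by blast
    then have "\<H> \<in> range \<G>" using \<G> by simp
    then obtain n where n: "\<H> = \<G> n" by blast
    have "star x \<H> \<subseteq> topspace X" unfolding star_def n using op openin_subset by blast
    then show "\<exists>n. x \<in> star x (\<G> n) \<and> star x (\<G> n) \<subseteq> topspace X - {y}"
      using \<H> n by blast
  qed
qed

lemma quasi_G_delta_diagonal_obtain_countable_families: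
  assumes "quasi_G_delta_diagonal X"
  obtains \<AA> where "countable \<AA>" "\<And>\<G> U. \<lbrakk>\<G> \<in> \<AA>; U \<in> \<G>\<rbrakk> \<Longrightarrow> openin X U"
    "\<And>x y. \<lbrakk>x \<in> topspace X; y \<in> topspace X; x \<noteq> y\<rbrakk> \<Longrightarrow> \<exists>\<G>\<in>\<AA>. x \<in> star x \<G> \<and> y \<notin> star x \<G>"
proof -
  obtain \<G> :: "nat \<Rightarrow> 'a set set" where \<G>: "\<forall>n. \<forall>U\<in>\<G> n. openin X U"
    "\<forall>x\<in>topspace X. \<forall>y\<in>topspace X. x \<noteq> y \<longrightarrow>
       (\<exists>n. x \<in> star x (\<G> n) \<and> star x (\<G> n) \<subseteq> topspace X - {y})"
    using assms unfolding quasi_G_delta_diagonal_def by blast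
  show thesis
  proof (rule that[of "range \<G>"])
    show "openin X U" if "\<H> \<in> range \<G>" "U \<in> \<H>" for \<H> U using that \<G>(1) by blast
    show "\<exists>\<H>\<in>range \<G>. x \<in> star x \<H> \<and> y \<notin> star x \<H>"
      if "x \<in> topspace X" "y \<in> topspace X" "x \<noteq> y" for x y
      using \<G>(2) that by blast
  qed simp
qed

lemma quasi_G_delta_diagonal_restrict_families:
  assumes "countable \<AA>" "\<And>\<G> U. \<lbrakk>\<G> \<in> \<AA>; U \<in> \<G>\<rbrakk> \<Longrightarrow> openin X U"
    and "\<And>x y. \<lbrakk>x \<in> S; y \<in> S; x \<noteq> y\<rbrakk> \<Longrightarrow> \<exists>\<G>\<in>\<AA>. x \<in> star x \<G> \<and> y \<notin> star x \<G>"
  shows "quasi_G_delta_diagonal (subtopology X S)"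
proof (rule quasi_G_delta_diagonal_countable_families)
  show "countable ((\<lambda>\<G>. (\<lambda>U. U \<inter> S) ` \<G>) ` \<AA>)" using assms(1) by simp
  show "openin (subtopology X S) U" if "\<H> \<in> (\<lambda>\<G>. (\<lambda>U. U \<inter> S) ` \<G>) ` \<AA>" "U \<in> \<H>" for \<H> U
    using that assms(2) by (auto simp: openin_subtopology)
  fix x y assume "x \<in> topspace (subtopology X S)" "y \<in> topspace (subtopology X S)" "x \<noteq> y"
  then have xy: "x \<in> S" "y \<in> S" "x \<noteq> y" by auto
  then obtain \<G> where \<G>: "\<G> \<in> \<AA>" "x \<in> star x \<G>" "y \<notin> star x \<G>" using assms(3) by blast
  have "x \<in> star x ((\<lambda>U. U \<inter> S) ` \<G>) \<and> y \<notin> star x ((\<lambda>U. U \<inter> S) ` \<G>)"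
    using \<G>(2,3) xy unfolding star_def by blast
  then show "\<exists>\<H>\<in>(\<lambda>\<G>. (\<lambda>U. U \<inter> S) ` \<G>) ` \<AA>. x \<in> star x \<H> \<and> y \<notin> star x \<H>"
    using \<G>(1) by blast
qed

lemma quasi_G_delta_diagonal_subtopology:
  assumes "quasi_G_delta_diagonal X"
  shows "quasi_G_delta_diagonal (subtopology X S)"
proof -
  obtain \<AA> where \<AA>: "countable \<AA>" "\<And>\<G> U. \<lbrakk>\<G> \<in> \<AA>; U \<in> \<G>\<rbrakk> \<Longrightarrow> openin X U"
    "\<And>x y. \<lbrakk>x \<in> topspace X; y \<in> topspace X; x \<noteq> y\<rbrakk> \<Longrightarrow> \<exists>\<G>\<in>\<AA>. x \<in> star x \<G> \<and> y \<notin> star x \<G>"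
    using quasi_G_delta_diagonal_obtain_countable_families[OF assms] by blast
  have "quasi_G_delta_diagonal (subtopology X (topspace X \<inter> S))"
    by (rule quasi_G_delta_diagonal_restrict_families[OF \<AA>(1,2)]) (use \<AA>(3) in auto)
  then show ?thesis by (simp add: subtopology_restrict)
qed

text \<open>
The families that come with a neighbourhood \<open>U\<close> say nothing about points outside \<open>U\<close>. The one-member
family \<open>{U}\<close> separates the points of \<open>U\<close> from those, so countably many neighbourhoods covering \<open>F\<close>
yield a countable system that works for \<open>F\<close> against the whole space.
\<close>

lemma has_locally_quasi_G_delta_diagonal_on_Lindelof:
  assumes loc: "has_locally quasi_G_delta_diagonal Y" and F: "F \<subseteq> topspace Y"
    and lin: "Lindelof_space (subtopology Y F)"
  obtains \<AA> where "countable \<AA>" "\<And>\<G> U. \<lbrakk>\<G> \<in> \<AA>; U \<in> \<G>\<rbrakk> \<Longrightarrow> openin Y U"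
    "\<And>x y. \<lbrakk>x \<in> F; y \<in> topspace Y; x \<noteq> y\<rbrakk> \<Longrightarrow> \<exists>\<G>\<in>\<AA>. x \<in> star x \<G> \<and> y \<notin> star x \<G>"
proof -
  define good where "good U \<AA> \<longleftrightarrow> openin Y U \<and> countable \<AA> \<and> (\<forall>\<G>\<in>\<AA>. \<forall>V\<in>\<G>. openin Y V) \<and>
    (\<forall>x\<in>U. \<forall>y\<in>topspace Y. x \<noteq> y \<longrightarrow> (\<exists>\<G>\<in>\<AA>. x \<in> star x \<G> \<and> y \<notin> star x \<G>))" for U and \<AA> :: "'a set set set"
  have ex: "\<exists>U. x \<in> U \<and> (\<exists>\<AA>. good U \<AA>)" if x: "x \<in> F" for x
  proof -
    have xY: "x \<in> topspace Y" using x F by blast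
    obtain U V where UV: "openin Y U" "x \<in> U" "U \<subseteq> V" "V \<subseteq> topspace Y"
      and qV: "quasi_G_delta_diagonal (subtopology Y V)"
      by (rule has_locally_neighbourhood[OF loc xY])
    have "quasi_G_delta_diagonal (subtopology (subtopology Y V) U)"
      by (rule quasi_G_delta_diagonal_subtopology[OF qV])
    then have qU: "quasi_G_delta_diagonal (subtopology Y U)"
      using UV(3) by (simp add: subtopology_subtopology Int_absorb1)
    have topU: "topspace (subtopology Y U) = U" using openin_subset[OF UV(1)] by auto
    obtain \<AA> where \<AA>: "countable \<AA>" "\<And>\<G> W. \<lbrakk>\<G> \<in> \<AA>; W \<in> \<G>\<rbrakk> \<Longrightarrow> openin (subtopology Y U) W"
      "\<And>x y. \<lbrakk>x \<in> U; y \<in> U; x \<noteq> y\<rbrakk> \<Longrightarrow> \<exists>\<G>\<in>\<AA>. x \<in> star x \<G> \<and> y \<notin> star x \<G>"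
      using quasi_G_delta_diagonal_obtain_countable_families[OF qU, unfolded topU] by blast
    have "good U (insert {U} \<AA>)"
      unfolding good_def
    proof (intro conjI ballI impI)
      show "openin Y V" if "\<G> \<in> insert {U} \<AA>" "V \<in> \<G>" for \<G> V
      proof (cases "\<G> = {U}")
        case False
        then have "\<G> \<in> \<AA>" using that by blast
        then show ?thesis using \<AA>(2)[of \<G> V] that openin_trans_full[OF _ UV(1)] by blast
      qed (use that UV in auto)
      show "\<exists>\<G>\<in>insert {U} \<AA>. x \<in> star x \<G> \<and> y \<notin> star x \<G>"
        if xy: "x \<in> U" "y \<in> topspace Y" "x \<noteq> y" for x y
      proof (cases "y \<in> U")
        case True
        then show ?thesis using \<AA>(3)[OF xy(1) True xy(3)] by blast
      next
        case False
        then have "x \<in> star x {U} \<and> y \<notin> star x {U}" using xy by (simp add: star_def)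
        then show ?thesis by blast
      qed
    qed (use UV \<AA>(1) in auto)
    then show ?thesis using UV(2) by blast
  qed
  define \<U> where "\<U> = {U. \<exists>\<AA>. good U \<AA>}"
  have "\<forall>U\<in>\<U>. openin Y U" by (auto simp: \<U>_def good_def)
  moreover have "topspace Y \<inter> F \<subseteq> \<Union>\<U>"
  proof
    fix x assume "x \<in> topspace Y \<inter> F"
    then obtain U where "x \<in> U" "\<exists>\<AA>. good U \<AA>" using ex[of x] by (elim IntE) metis
    then show "x \<in> \<Union>\<U>" by (auto simp: \<U>_def)
  qed
  ultimately obtain \<V> where \<V>: "countable \<V>" "\<V> \<subseteq> \<U>" "topspace Y \<inter> F \<subseteq> \<Union>\<V>"
    using lin unfolding Lindelof_space_subtopology by meson
  have "\<forall>U\<in>\<V>. \<exists>\<AA>. good U \<AA>" using \<V>(2) by (auto simp: \<U>_def)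
  from bchoice[OF this] obtain \<AA> where \<AA>: "\<forall>U\<in>\<V>. good U (\<AA> U)" ..
  show thesis
  proof (rule that[of "\<Union>U\<in>\<V>. \<AA> U"])
    show "countable (\<Union>U\<in>\<V>. \<AA> U)" using \<V>(1) \<AA> by (auto simp: good_def)
    show "openin Y V" if "\<G> \<in> (\<Union>U\<in>\<V>. \<AA> U)" "V \<in> \<G>" for \<G> V
      using that \<AA> by (auto simp: good_def)
    show "\<exists>\<G>\<in>(\<Union>U\<in>\<V>. \<AA> U). x \<in> star x \<G> \<and> y \<notin> star x \<G>"
      if xy: "x \<in> F" "y \<in> topspace Y" "x \<noteq> y" for x y
    proof -
      obtain U where U: "U \<in> \<V>" "x \<in> U" using xy(1) \<V>(3) F by blast
      then have "good U (\<AA> U)" using \<AA> by blast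
      then obtain \<G> where "\<G> \<in> \<AA> U" "x \<in> star x \<G> \<and> y \<notin> star x \<G>"
        using U(2) xy unfolding good_def by blast
      then show ?thesis using U(1) by blast
    qed
  qed
qed

section \<open>Compact spaces with a quasi-\<open>G\<^sub>\<delta>\<close>-diagonal\<close>

text \<open>
\<open>\<omega>\<close> rounds of adding values of \<open>\<Psi>\<close> suffice, because a list has only finitely many entries and so
already lives in one round.
\<close>

lemma countable_closing_off:
  fixes \<Psi> :: "'x list \<Rightarrow> 'x set"
  assumes "\<And>l. countable (\<Psi> l)"
  obtains F where "countable F" "\<And>l. set l \<subseteq> F \<Longrightarrow> \<Psi> l \<subseteq> F"
proof -
  define N where "N = rec_nat {} (\<lambda>_ A. A \<union> (\<Union>l\<in>lists A. \<Psi> l))"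
  have N0: "N 0 = {}" and NS: "N (Suc k) = N k \<union> (\<Union>l\<in>lists (N k). \<Psi> l)" for k
    by (simp_all add: N_def)
  have cN: "countable (N k)" for k
    by (induction k) (auto simp: N0 NS assms)
  have mono: "N j \<subseteq> N k" if "j \<le> k" for j k
    using that by (rule lift_Suc_mono_le[rotated]) (auto simp: NS)
  have "\<Psi> l \<subseteq> (\<Union>k. N k)" if "set l \<subseteq> (\<Union>k. N k)" for l
  proof -
    have "\<exists>k. set l \<subseteq> N k"
      using that
    proof (induction l)
      case (Cons a l)
      then obtain j k where "a \<in> N j" "set l \<subseteq> N k" by auto
      then have "set (a # l) \<subseteq> N (max j k)"
        using mono[of j "max j k"] mono[of k "max j k"] by auto
      then show ?case by blast
    qed auto
    then obtain k where "set l \<subseteq> N k" ..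
    then have "\<Psi> l \<subseteq> N (Suc k)" by (auto simp: NS in_lists_conv_set)
    then show ?thesis by blast
  qed
  moreover have "countable (\<Union>k. N k)" using cN by blast
  ultimately show thesis using that by blast
qed

text \<open>
Let \<open>A n\<close> be the closed set on which the \<open>n\<close>-th family says nothing. If \<open>A n\<close> were empty for all \<open>n\<close>,
finite subcovers would provide countably many separating functions. In general the finite subcovers
exist only for closed sets that avoid \<open>A n\<close>, and to have enough of these a countable set \<open>F\<close> of
functions is closed off as follows. Whenever a box, given by finitely many rational bounds on
members of \<open>F\<close>, becomes covered by the \<open>n\<close>-th family after intersecting it with finitely many of the
sets \<open>A m\<close>, the functions belonging to a finite subcover are in \<open>F\<close>.

Suppose \<open>F\<close> does not separate \<open>x\<close> and \<open>y\<close>, and let \<open>E\<close> be the set of all points that \<open>F\<close> does not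
separate from \<open>x\<close>. Intersect \<open>E\<close> successively with \<open>A 0\<close>, \<open>A 1\<close>, and so on, skipping each set that
would make the intersection empty; by compactness some \<open>z\<close> survives. Let \<open>w\<close> be another point of \<open>E\<close>
and let the \<open>n\<close>-th family separate \<open>z\<close> from \<open>w\<close>. Then \<open>A n\<close> was skipped, so a box around \<open>E\<close>,
intersected with finitely many \<open>A m\<close>, avoids \<open>A n\<close>, and a function of \<open>F\<close> separates \<open>z\<close> from \<open>w\<close>,
which is impossible inside \<open>E\<close>.
\<close>

lemma quasi_G_delta_diagonal_obtain_separating_functions:
  assumes K: "compact_space K" "Hausdorff_space K" and q: "quasi_G_delta_diagonal K"
  obtains F :: "('a \<Rightarrow> real) set" where "countable F"
    "\<And>f. f \<in> F \<Longrightarrow> continuous_map K euclideanreal f"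
    "\<And>x y. \<lbrakk>x \<in> topspace K; y \<in> topspace K; x \<noteq> y\<rbrakk> \<Longrightarrow> \<exists>f\<in>F. f x \<noteq> f y"
proof -
  obtain \<G> :: "nat \<Rightarrow> 'a set set" where
    op: "\<And>n U. U \<in> \<G> n \<Longrightarrow> openin K U" and
    sep: "\<And>x y. \<lbrakk>x \<in> topspace K; y \<in> topspace K; x \<noteq> y\<rbrakk>
       \<Longrightarrow> \<exists>n. x \<in> star x (\<G> n) \<and> star x (\<G> n) \<subseteq> topspace K - {y}"
    using q unfolding quasi_G_delta_diagonal_def by metis
  have creg: "completely_regular_space K"
    using K compact_Hausdorff_or_regular_imp_normal_space normal_imp_completely_regular_space
    by blast
  define A where "A n = topspace K - \<Union>(\<G> n)" for n
  have clA: "closedin K (A n)" for n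
    unfolding A_def using op by (intro closedin_diff) auto
  define B where "B L = {x \<in> topspace K. \<forall>(f, a, b)\<in>set L. a \<le> f x \<and> f x \<le> b}"
    for L :: "(('a \<Rightarrow> real) \<times> real \<times> real) list"
  define AT where "AT T = {x \<in> topspace K. \<forall>m\<in>set T. x \<in> A m}" for T
  have clAT: "closedin K (AT T)" for T
  proof -
    have "AT T = topspace K \<inter> (\<Inter>m\<in>set T. A m)" by (auto simp: AT_def)
    moreover have "closedin K (topspace K \<inter> (\<Inter>m\<in>set T. A m))"
      by (induction T) (auto simp: Int_left_commute closedin_Int clA)
    ultimately show ?thesis by metis
  qed
  \<comment> \<open>A function that is less than \<open>1\<close> at \<open>z\<close> and equal to \<open>1\<close> off some member \<open>V\<close> containing \<open>z\<close> certifies what the star of \<open>z\<close> excludes.\<close>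
  have step: "\<exists>\<Phi>. finite \<Phi> \<and> (\<forall>g\<in>\<Phi>. continuous_map K euclideanreal g) \<and>
      (\<forall>z \<in> C. \<exists>g\<in>\<Phi>. \<exists>V\<in>\<G> n. z \<in> V \<and> (\<forall>y\<in>topspace K - V. g y \<noteq> g z))"
    if C: "closedin K C" "C \<subseteq> \<Union>(\<G> n)" for C n
  proof -
    define Q where "Q = {(g, V). V \<in> \<G> n \<and> continuous_map K euclideanreal g \<and>
        (\<forall>y\<in>topspace K - V. g y = (1::real))}"
    define W where "W = (\<lambda>(g, V). {x \<in> topspace K. g x < (1::real)} \<inter> V)"
    have "C \<subseteq> \<Union>(W ` Q)"
    proof
      fix z assume z: "z \<in> C"
      then obtain V where V: "V \<in> \<G> n" "z \<in> V" using C by blast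
      have zK: "closedin K (topspace K - V)" "z \<in> topspace K - (topspace K - V)"
        using V op[OF V(1)] openin_subset by blast+
      then obtain g where g: "continuous_map K (top_of_set {0..1::real}) g" "g z = 0"
        "g ` (topspace K - V) \<subseteq> {1}"
        using creg unfolding completely_regular_space_def by meson
      then have "(g, V) \<in> Q"
        using V by (auto simp: Q_def continuous_map_in_subtopology)
      moreover have "z \<in> W (g, V)"
        using V g zK by (simp add: W_def)
      ultimately show "z \<in> \<Union>(W ` Q)" by blast
    qed
    moreover have "openin K U" if U: "U \<in> W ` Q" for U
    proof -
      obtain g V where *: "U = {x \<in> topspace K. g x < 1} \<inter> V" "V \<in> \<G> n"
        "continuous_map K euclideanreal g"
        using U by (auto simp: W_def Q_def)
      have "openin K {x \<in> topspace K. g x \<in> {..<1}}"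
        using * by (intro openin_continuous_map_preimage) auto
      then show ?thesis using * op by (auto intro: openin_Int)
    qed
    moreover have "compactin K C"
      using C K closedin_compact_space by blast
    ultimately obtain \<O> where \<O>: "finite \<O>" "\<O> \<subseteq> W ` Q" "C \<subseteq> \<Union>\<O>"
      using compactinD[of K C "W ` Q"] by blast
    then obtain Q' where Q': "finite Q'" "Q' \<subseteq> Q" "\<O> = W ` Q'"
      using finite_subset_image by metis
    show ?thesis
    proof (intro exI[of _ "fst ` Q'"] conjI ballI)
      fix z assume "z \<in> C"
      then obtain t where "t \<in> Q'" "z \<in> W t" using \<O>(3) Q'(3) by blast
      then obtain g V where gV: "(g, V) \<in> Q'" "z \<in> W (g, V)" by (cases t) auto
      show "\<exists>h\<in>fst ` Q'. \<exists>V\<in>\<G> n. z \<in> V \<and> (\<forall>y\<in>topspace K - V. h y \<noteq> h z)"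
      proof (intro bexI conjI ballI)
        have gQ: "(g, V) \<in> Q" using gV Q'(2) by blast
        show "g \<in> fst ` Q'" using gV(1) by force
        show "V \<in> \<G> n" "z \<in> V" using gQ gV(2) by (simp_all add: Q_def W_def)
        show "g y \<noteq> g z" if "y \<in> topspace K - V" for y
          using gQ gV(2) that by (auto simp: Q_def W_def)
      qed
    qed (use Q' in \<open>auto simp: Q_def\<close>)
  qed
  define ok where "ok C n \<Phi> \<longleftrightarrow> finite \<Phi> \<and> (\<forall>g\<in>\<Phi>. continuous_map K euclideanreal g) \<and>
      (closedin K C \<longrightarrow> C \<subseteq> \<Union>(\<G> n) \<longrightarrow>
      (\<forall>z \<in> C. \<exists>g\<in>\<Phi>. \<exists>V\<in>\<G> n. z \<in> V \<and> (\<forall>y\<in>topspace K - V. g y \<noteq> g z)))" for C n \<Phi>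
  have "\<exists>\<Phi>. ok C n \<Phi>" for C n
    using step[of C n] unfolding ok_def by (cases "closedin K C \<and> C \<subseteq> \<Union>(\<G> n)") (blast, auto)
  then obtain \<Phi> where \<Phi>: "\<And>C n. ok C n (\<Phi> C n)" by metis
  \<comment> \<open>Lists of functions are paired with lists of rational bounds, so that countably many boxes arise from each list.\<close>
  define \<Psi> where "\<Psi> fs = (\<Union>ab\<in>lists (\<rat> \<times> \<rat>). \<Union>T::nat list. \<Union>n.
      \<Phi> (B (zip fs ab) \<inter> AT T) n)" for fs
  have "countable (\<Psi> fs)" for fs
    unfolding \<Psi>_def using \<Phi> ok_def
    by (intro countable_UN countable_lists countable_SIGMA countable_rat countableI_type)
      (auto intro: countable_finite)
  then obtain F0 where F0: "countable F0" "\<And>l. set l \<subseteq> F0 \<Longrightarrow> \<Psi> l \<subseteq> F0"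
    using countable_closing_off[of \<Psi>] by blast
  define F where "F = {f \<in> F0. continuous_map K euclideanreal f}"
  have F: "\<Psi> l \<subseteq> F" if "set l \<subseteq> F" for l
  proof -
    have "\<Psi> l \<subseteq> F0" using F0(2)[of l] that by (auto simp: F_def)
    moreover have "continuous_map K euclideanreal g" if "g \<in> \<Psi> l" for g
      using that \<Phi> unfolding \<Psi>_def ok_def by blast
    ultimately show ?thesis by (auto simp: F_def)
  qed
  show thesis
  proof (rule that)
    show "countable F" using F0(1) by (simp add: F_def)
    show "continuous_map K euclideanreal f" if "f \<in> F" for f
      using that by (simp add: F_def)
    fix x y assume xy: "x \<in> topspace K" "y \<in> topspace K" "x \<noteq> y"
    show "\<exists>f\<in>F. f x \<noteq> f y"
    proof (rule ccontr)
      assume "\<not> ?thesis"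
      then have fxy: "f x = f y" if "f \<in> F" for f using that by blast
      define E where "E = {u \<in> topspace K. \<forall>f\<in>F. f u = f x}"
      \<comment> \<open>The successive intersections of \<open>E\<close> with the sets \<open>A n\<close>, skipping those that would leave nothing.\<close>
      define H where "H = rec_nat E (\<lambda>n C. if C \<inter> A n \<noteq> {} then C \<inter> A n else C)"
      have H0: "H 0 = E" and HS: "H (Suc n) = (if H n \<inter> A n \<noteq> {} then H n \<inter> A n else H n)" for n
        by (simp_all add: H_def)
      have clE: "closedin K E"
      proof -
        have "closedin K {u \<in> topspace K. f u \<in> {f x}}" if "f \<in> F" for f
          using that by (intro closedin_continuous_map_preimage[of _ euclideanreal]) (auto simp: F_def)
        then have "closedin K (\<Inter>(insert (topspace K) ((\<lambda>f. {u \<in> topspace K. f u \<in> {f x}}) ` F)))"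
          by (intro closedin_Inter) auto
        moreover have "E = (\<Inter>(insert (topspace K) ((\<lambda>f. {u \<in> topspace K. f u \<in> {f x}}) ` F)))"
          by (auto simp: E_def)
        ultimately show ?thesis by simp
      qed
      have HT: "\<exists>T. H n = E \<inter> AT T" for n
      proof (induction n)
        case 0
        have "E = E \<inter> AT []" by (auto simp: E_def AT_def)
        then show ?case unfolding H0 by blast
      next
        case (Suc n)
        then obtain T where T: "H n = E \<inter> AT T" by blast
        then have "H n \<inter> A n = E \<inter> AT (n # T)" by (auto simp: AT_def)
        then show ?case using T HS by metis
      qed
      have clH: "closedin K (H n)" for n
        using HT[of n] clE clAT closedin_Int by metis
      have neH: "H n \<noteq> {}" for n
      proof (induction n)
        case 0 show ?case using xy by (auto simp: H0 E_def)
      qed (auto simp: HS)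
      have "decseq H"
        by (rule decseq_SucI) (auto simp: HS)
      then have "(\<Inter>n. H n) \<noteq> {}"
        using compact_space_imp_nest[of K H] K(1) clH neH by blast
      then obtain z where z: "\<And>n. z \<in> H n" by blast
      then have zE: "z \<in> E" using H0 by auto
      obtain w where w: "w \<in> {x, y}" "w \<noteq> z" using xy by auto
      then have wE: "w \<in> E" using xy fxy[symmetric] by (auto simp: E_def)
      obtain n where n: "z \<in> star z (\<G> n)" "star z (\<G> n) \<subseteq> topspace K - {w}"
        using sep[of z w] zE wE w unfolding E_def by auto
      have "z \<notin> A n" using n by (auto simp: A_def star_def)
      then have Hn: "H n \<inter> A n = {}" using z[of "Suc n"] HS[of n] by (auto split: if_splits)
      obtain T where T: "H n = E \<inter> AT T" using HT by blast
      \<comment> \<open>\<open>E\<close> is the intersection of all boxes containing \<open>x\<close>; compactness of \<open>AT T \<inter> A n\<close> leaves finitely many bounds.\<close>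
      define Q where "Q = {(f, a, b). f \<in> F \<and> a \<in> \<rat> \<and> b \<in> \<rat> \<and> a \<le> f x \<and> f x \<le> b}"
      define W where "W = (\<lambda>(f, a::real, b). {u \<in> topspace K. f u < a \<or> f u > b})"
      have opO: "openin K U" if U: "U \<in> W ` Q" for U
      proof -
        obtain f a b where *: "U = {u \<in> topspace K. f u < a \<or> f u > b}" "f \<in> F"
          using U by (auto simp: W_def Q_def)
        have "openin K {u \<in> topspace K. f u \<in> {..<a} \<union> {b<..}}"
          using * by (intro openin_continuous_map_preimage) (auto simp: F_def)
        then show ?thesis using * by simp
      qed
      have "AT T \<inter> A n \<subseteq> \<Union>(W ` Q)"
      proof
        fix u assume u: "u \<in> AT T \<inter> A n"
        then have uK: "u \<notin> E" "u \<in> topspace K" using Hn T by (auto simp: AT_def)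
        then obtain f where f: "f \<in> F" "f u \<noteq> f x" by (auto simp: E_def)
        have "\<exists>a b. a \<in> \<rat> \<and> b \<in> \<rat> \<and> a \<le> f x \<and> f x \<le> b \<and> (f u < a \<or> f u > b)"
        proof (cases "f u < f x")
          case True
          then obtain a b where "a \<in> \<rat>" "f u < a" "a < f x" "b \<in> \<rat>" "f x < b"
            using Rats_dense_in_real[OF True] Rats_dense_in_real[of "f x" "f x + 1"] by auto
          then show ?thesis by (intro exI[of _ a] exI[of _ b]) auto
        next
          case False
          then have less: "f x < f u" using f by simp
          then obtain a b where "a \<in> \<rat>" "a < f x" "b \<in> \<rat>" "f x < b" "b < f u"
            using Rats_dense_in_real[OF less] Rats_dense_in_real[of "f x - 1" "f x"] by auto
          then show ?thesis by (intro exI[of _ a] exI[of _ b]) auto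
        qed
        then obtain a b where ab: "a \<in> \<rat>" "b \<in> \<rat>" "a \<le> f x" "f x \<le> b" "f u < a \<or> f u > b" by blast
        then have "(f, a, b) \<in> Q" "u \<in> W (f, a, b)"
          using f uK by (auto simp: Q_def W_def)
        then show "u \<in> \<Union>(W ` Q)" by blast
      qed
      moreover have "compactin K (AT T \<inter> A n)"
        using K clAT clA closedin_compact_space by blast
      ultimately obtain \<O> where \<O>: "finite \<O>" "\<O> \<subseteq> W ` Q" "AT T \<inter> A n \<subseteq> \<Union>\<O>"
        using opO compactinD[of K "AT T \<inter> A n" "W ` Q"] by blast
      then obtain Q' where Q': "finite Q'" "Q' \<subseteq> Q" "\<O> = W ` Q'"
        using finite_subset_image by metis
      obtain L where L: "set L = Q'" using finite_list[OF Q'(1)] by blast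
      define C where "C = B L \<inter> AT T"
      have C: "C = {u \<in> AT T. \<forall>(f, a, b)\<in>Q'. a \<le> f u \<and> f u \<le> b}"
        unfolding C_def B_def L by (auto simp: AT_def)
      have clC: "closedin K C"
      proof -
        let ?I = "\<lambda>(f, a, b). {u \<in> topspace K. f u \<in> {a..b}}"
        have "closedin K (?I t)" if t: "t \<in> Q'" for t
        proof -
          obtain f a b where *: "t = (f, a, b)" "f \<in> F" using t Q'(2) by (auto simp: Q_def)
          have "closedin K {u \<in> topspace K. f u \<in> {a..b}}"
            using * by (intro closedin_continuous_map_preimage[of _ euclideanreal]) (auto simp: F_def)
          then show ?thesis by (simp add: *)
        qed
        then have "closedin K (\<Inter>(insert (AT T) (?I ` Q')))"
          using clAT by (intro closedin_Inter) auto
        moreover have "C = (\<Inter>(insert (AT T) (?I ` Q')))"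
          by (auto simp: C AT_def)
        ultimately show ?thesis by simp
      qed
      have CG: "C \<subseteq> \<Union>(\<G> n)"
      proof
        fix u assume u: "u \<in> C"
        then have uT: "u \<in> AT T" "u \<in> topspace K" by (auto simp: C AT_def)
        have "u \<notin> W t" if "t \<in> Q'" for t
          using u that unfolding C W_def by force
        then have "u \<notin> A n" using \<O>(3) uT Q'(3) by blast
        then show "u \<in> \<Union>(\<G> n)" using uT by (simp add: A_def)
      qed
      have zC: "z \<in> C"
      proof -
        have "a \<le> f z \<and> f z \<le> b" if "(f, a, b) \<in> Q'" for f a b
        proof -
          have "(f, a, b) \<in> Q" using that Q'(2) by blast
          then show ?thesis using zE by (auto simp: Q_def E_def)
        qed
        then show ?thesis using z[of n] T unfolding C by auto
      qed
      obtain g V where gV: "g \<in> \<Phi> C n" "V \<in> \<G> n" "z \<in> V" "\<forall>y\<in>topspace K - V. g y \<noteq> g z"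
        using \<Phi>[of C n] zC clC CG unfolding ok_def by blast
      have LQ: "fst t \<in> F \<and> snd t \<in> \<rat> \<times> \<rat>" if "t \<in> set L" for t
      proof -
        have "t \<in> Q" using that L Q'(2) by blast
        then show ?thesis by (auto simp: Q_def)
      qed
      then have "map snd L \<in> lists (\<rat> \<times> \<rat>)" by (auto simp: in_lists_conv_set)
      moreover have "g \<in> \<Phi> (B (zip (map fst L) (map snd L)) \<inter> AT T) n"
        using gV(1) by (simp add: C_def zip_map_fst_snd)
      ultimately have "g \<in> \<Psi> (map fst L)" unfolding \<Psi>_def by blast
      moreover have "set (map fst L) \<subseteq> F" using LQ by auto
      ultimately have "g \<in> F" using F by blast
      have "w \<notin> V" using n(2) gV unfolding star_def by blast
      then have "g w \<noteq> g z" using gV(4) wE by (auto simp: E_def)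
      then show False using \<open>g \<in> F\<close> zE wE by (auto simp: E_def)
    qed
  qed
qed

text \<open>
Countably many separating continuous functions embed a compact space into the countable power of the
real line.
\<close>

lemma compact_quasi_G_delta_diagonal_imp_second_countable_metrizable:
  assumes K: "compact_space K" "Hausdorff_space K" and q: "quasi_G_delta_diagonal K"
  shows "second_countable K" "metrizable_space K"
proof -
  obtain F :: "('a \<Rightarrow> real) set" where F: "countable F"
    "\<And>f. f \<in> F \<Longrightarrow> continuous_map K euclideanreal f"
    "\<And>x y. \<lbrakk>x \<in> topspace K; y \<in> topspace K; x \<noteq> y\<rbrakk> \<Longrightarrow> \<exists>f\<in>F. f x \<noteq> f y"
    using quasi_G_delta_diagonal_obtain_separating_functions[OF assms] by blast
  define F' where "F' = insert (\<lambda>_. 0) F"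
  obtain f :: "nat \<Rightarrow> 'a \<Rightarrow> real" where f: "range f = F'"
    using F(1) uncountable_def[of F'] by (auto simp: F'_def)
  have cf: "continuous_map K euclideanreal (f k)" for k
  proof -
    have "f k \<in> F'" using f by blast
    then show ?thesis using F(2) by (auto simp: F'_def)
  qed
  define h where "h x = (\<lambda>k. f k x)" for x
  have "continuous_map K (product_topology (\<lambda>i. euclidean) UNIV) h"
    using cf by (auto simp: h_def continuous_map_componentwise_UNIV)
  then have "continuous_map K euclidean h" by (simp add: euclidean_product_topology)
  moreover have "inj_on h (topspace K)"
  proof (rule inj_onI, rule ccontr)
    fix x y assume *: "x \<in> topspace K" "y \<in> topspace K" "h x = h y" "x \<noteq> y"
    then obtain g where "g \<in> F" "g x \<noteq> g y" using F(3) by blast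
    moreover then obtain k where "g = f k" using f F'_def by (metis imageE insertCI)
    ultimately show False using *(3) by (metis h_def)
  qed
  moreover have "Hausdorff_space (euclidean :: (nat \<Rightarrow> real) topology)" by simp
  ultimately have "embedding_map K euclidean h"
    using continuous_imp_embedding_map K by blast
  then have hom: "K homeomorphic_space (top_of_set (h ` topspace K))"
    by (rule embedding_map_imp_homeomorphic_space)
  have "second_countable (euclidean :: (nat \<Rightarrow> real) topology)"
  proof -
    obtain B :: "(nat \<Rightarrow> real) set set" where "countable B" "topological_basis B"
      using ex_countable_basis by blast
    then show ?thesis unfolding second_countable_def
      by (metis openin_open_trans open_openin openin_subopen topological_basisE topological_basis_open)
  qed
  then show "second_countable K"
    using hom second_countable_subtopology homeomorphic_space_second_countability by blast
  show "metrizable_space K"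
    using hom metrizable_space_subtopology metrizable_space_euclidean homeomorphic_metrizable_space
    by blast
qed
text \<open>
Being second countable, \<open>F\<close> needs only countably many members of each family to cover what the whole
family covers of it. These members separate each point of \<open>F\<close> from each point outside \<open>F\<close>, and the
finite unions of them that contain \<open>F\<close> intersect in \<open>F\<close>.
\<close>

lemma compact_in_locally_quasi_G_delta_diagonal_is_G_delta:
  assumes haus: "Hausdorff_space Y" and loc: "has_locally quasi_G_delta_diagonal Y" and F: "compactin Y F"
  obtains \<O> where "countable \<O>" "\<And>O'. O' \<in> \<O> \<Longrightarrow> openin Y O' \<and> F \<subseteq> O'"
    "\<And>x. x \<in> topspace Y - F \<Longrightarrow> \<exists>O'\<in>\<O>. x \<notin> O'"
proof -
  have FY: "F \<subseteq> topspace Y" by (rule compactin_subset_topspace[OF F])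
  have cF: "compact_space (subtopology Y F)" by (rule compact_space_subtopology[OF F])
  obtain \<AA> where \<AA>: "countable \<AA>" "\<And>\<G> U. \<lbrakk>\<G> \<in> \<AA>; U \<in> \<G>\<rbrakk> \<Longrightarrow> openin Y U"
    "\<And>x y. \<lbrakk>x \<in> F; y \<in> topspace Y; x \<noteq> y\<rbrakk> \<Longrightarrow> \<exists>\<G>\<in>\<AA>. x \<in> star x \<G> \<and> y \<notin> star x \<G>"
    using has_locally_quasi_G_delta_diagonal_on_Lindelof[OF loc FY compact_imp_Lindelof_space[OF cF]]
    by blast
  have "quasi_G_delta_diagonal (subtopology Y F)"
  proof (rule quasi_G_delta_diagonal_restrict_families[OF \<AA>(1,2)])
    show "\<exists>\<G>\<in>\<AA>. x \<in> star x \<G> \<and> y \<notin> star x \<G>" if "x \<in> F" "y \<in> F" "x \<noteq> y" for x y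
      using that FY by (intro \<AA>(3)) auto
  qed
  then have sc: "second_countable (subtopology Y F)"
    by (intro compact_quasi_G_delta_diagonal_imp_second_countable_metrizable cF
        Hausdorff_space_subtopology haus)
  have "\<exists>\<W>. countable \<W> \<and> \<W> \<subseteq> \<G> \<and> F \<inter> \<Union>\<G> \<subseteq> \<Union>\<W>" if \<G>: "\<G> \<in> \<AA>" for \<G>
  proof -
    have "Lindelof_space (subtopology (subtopology Y F) (\<Union>\<G>))"
      by (intro second_countable_imp_Lindelof_space second_countable_subtopology sc)
    then have "Lindelof_space (subtopology Y (F \<inter> \<Union>\<G>))" by (simp add: subtopology_subtopology)
    moreover have "\<forall>U\<in>\<G>. openin Y U" using \<AA>(2) \<G> by blast
    ultimately have "\<exists>\<W>. countable \<W> \<and> \<W> \<subseteq> \<G> \<and> topspace Y \<inter> (F \<inter> \<Union>\<G>) \<subseteq> \<Union>\<W>"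
      unfolding Lindelof_space_subtopology by (elim allE[of _ \<G>]) auto
    moreover have "topspace Y \<inter> (F \<inter> \<Union>\<G>) = F \<inter> \<Union>\<G>" using FY by blast
    ultimately show ?thesis by simp
  qed
  then have "\<forall>\<G>\<in>\<AA>. \<exists>\<W>. countable \<W> \<and> \<W> \<subseteq> \<G> \<and> F \<inter> \<Union>\<G> \<subseteq> \<Union>\<W>" ..
  from bchoice[OF this] obtain \<W> where \<W>: "\<forall>\<G>\<in>\<AA>. countable (\<W> \<G>) \<and> \<W> \<G> \<subseteq> \<G> \<and> F \<inter> \<Union>\<G> \<subseteq> \<Union>(\<W> \<G>)" ..
  define \<S> where "\<S> = (\<Union>\<G>\<in>\<AA>. \<W> \<G>)"
  have \<S>: "countable \<S>" unfolding \<S>_def using \<AA>(1) \<W> by blast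
  have \<S>op: "openin Y U" if "U \<in> \<S>" for U
    using that \<W> \<AA>(2) unfolding \<S>_def by blast
  have \<S>sep: "\<exists>W\<in>\<S>. k \<in> W \<and> x \<notin> W" if k: "k \<in> F" and x: "x \<in> topspace Y - F" for k x
  proof -
    obtain \<G> where \<G>: "\<G> \<in> \<AA>" "k \<in> star k \<G>" "x \<notin> star k \<G>"
      using \<AA>(3)[of k x] k x by blast
    then have "k \<in> F \<inter> \<Union>\<G>" using k by (auto simp: star_def)
    then obtain W where W: "W \<in> \<W> \<G>" "k \<in> W" using \<W> \<G>(1) by blast
    then have "W \<in> \<G>" using \<W> \<G>(1) by blast
    then have "x \<notin> W" using \<G>(3) W(2) by (auto simp: star_def)
    then show ?thesis using W \<G>(1) unfolding \<S>_def by blast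
  qed
  show thesis
  proof (rule that[of "Union ` {\<V>. finite \<V> \<and> \<V> \<subseteq> \<S> \<and> F \<subseteq> \<Union>\<V>}"])
    have "{\<V>. finite \<V> \<and> \<V> \<subseteq> \<S> \<and> F \<subseteq> \<Union>\<V>} \<subseteq> {\<V>. finite \<V> \<and> \<V> \<subseteq> \<S>}" by blast
    then show "countable (Union ` {\<V>. finite \<V> \<and> \<V> \<subseteq> \<S> \<and> F \<subseteq> \<Union>\<V>})"
      by (intro countable_image countable_subset[OF _ countable_Collect_finite_subset[OF \<S>]])
    show "openin Y O' \<and> F \<subseteq> O'" if O': "O' \<in> Union ` {\<V>. finite \<V> \<and> \<V> \<subseteq> \<S> \<and> F \<subseteq> \<Union>\<V>}" for O'
    proof -
      obtain \<V> where "O' = \<Union>\<V>" "\<V> \<subseteq> \<S>" "F \<subseteq> \<Union>\<V>" using O' by blast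
      moreover have "openin Y (\<Union>\<V>)" by (rule openin_Union) (use \<open>\<V> \<subseteq> \<S>\<close> \<S>op in blast)
      ultimately show ?thesis by simp
    qed
    fix x assume x: "x \<in> topspace Y - F"
    define \<R> where "\<R> = {W \<in> \<S>. x \<notin> W}"
    have "F \<subseteq> \<Union>\<R>" using \<S>sep[OF _ x] unfolding \<R>_def by blast
    moreover have "openin Y W" if "W \<in> \<R>" for W using that \<S>op unfolding \<R>_def by simp
    ultimately obtain \<V> where \<V>: "finite \<V>" "\<V> \<subseteq> \<R>" "F \<subseteq> \<Union>\<V>"
      using compactinD[OF F, of \<R>] by blast
    then have "\<V> \<subseteq> \<S>" unfolding \<R>_def by blast
    have "\<Union>\<V> \<in> Union ` {\<V>. finite \<V> \<and> \<V> \<subseteq> \<S> \<and> F \<subseteq> \<Union>\<V>}"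
      by (rule imageI) (use \<V> \<open>\<V> \<subseteq> \<S>\<close> in simp)
    moreover have "x \<notin> \<Union>\<V>" using \<V>(2) unfolding \<R>_def by blast
    ultimately show "\<exists>O'\<in>Union ` {\<V>. finite \<V> \<and> \<V> \<subseteq> \<S> \<and> F \<subseteq> \<Union>\<V>}. x \<notin> O'"
      by (rule bexI[rotated])
  qed
qed

section \<open>Countably compact spaces with a quasi-\<open>G\<^sub>\<delta>\<close>-diagonal\<close>

text \<open>
Equivalent to the condition that every countable open cover has a finite subcover.
\<close>

definition countably_compact_space :: "'a topology \<Rightarrow> bool" where
  "countably_compact_space X \<longleftrightarrow>
     (\<forall>f :: nat \<Rightarrow> 'a. range f \<subseteq> topspace X \<longrightarrow>
        (\<exists>z \<in> topspace X. \<forall>U. openin X U \<and> z \<in> U \<longrightarrow> infinite {k. f k \<in> U}))"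

text \<open>
The idea is Chaber's proof for \<open>G\<^sub>\<delta>\<close>-diagonals. A maximal family \<open>M\<close> of closed sets with the finite
intersection property is closed under countable intersections, by countable compactness. For every
\<open>n\<close>, either the set \<open>A n\<close> left uncovered by the \<open>n\<close>-th family belongs to \<open>M\<close> or some member of \<open>M\<close>
avoids it. Intersecting these choices gives a member \<open>Z\<close> of \<open>M\<close> that each family either covers or
misses entirely, so on \<open>Z\<close> the families that cover form a genuine \<open>G\<^sub>\<delta>\<close>-diagonal sequence.

Let \<open>B n\<close> be the set of the \<open>y\<close> in \<open>Z\<close> such that \<open>M\<close> contains the complement of the star of \<open>y\<close>. If
\<open>B n\<close> met all members of \<open>M\<close>, one could pick infinitely many points of it with no two in a common
member of the \<open>n\<close>-th family, although that family covers their cluster point. Hence some \<open>p\<close> in \<open>Z\<close>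
lies outside all relevant \<open>B n\<close>, so each relevant star of \<open>p\<close> includes a member of \<open>M\<close>. As these
stars intersect in \<open>p\<close> alone, every member of \<open>M\<close> contains \<open>p\<close>.
\<close>

lemma countably_compact_quasi_G_delta_diagonal_imp_compact:
  assumes acc: "countably_compact_space X" and q: "quasi_G_delta_diagonal X"
  shows "compact_space X"
  unfolding compact_space_fip
proof (intro allI impI)
  fix \<U> :: "'a set set"
  assume \<U>: "(\<forall>C\<in>\<U>. closedin X C) \<and> (\<forall>\<F>. finite \<F> \<and> \<F> \<subseteq> \<U> \<longrightarrow> \<Inter>\<F> \<noteq> {})"
  show "\<Inter>\<U> \<noteq> {}"
  proof (cases "topspace X = {}")
    case True
    then have "\<U> \<subseteq> {{}}" using \<U> closedin_subset by fastforce
    then have "\<U> = {} \<or> \<U> = {{}}" by blast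
    then show ?thesis using \<U> by auto
  next
    case nonempty: False
    obtain \<G> :: "nat \<Rightarrow> 'a set set" where
      op: "\<And>n U. U \<in> \<G> n \<Longrightarrow> openin X U" and
      sep: "\<And>x y. \<lbrakk>x \<in> topspace X; y \<in> topspace X; x \<noteq> y\<rbrakk>
         \<Longrightarrow> \<exists>n. x \<in> star x (\<G> n) \<and> star x (\<G> n) \<subseteq> topspace X - {y}"
      using q unfolding quasi_G_delta_diagonal_def by metis
    define FIP where "FIP = {\<F>. \<U> \<subseteq> \<F> \<and> (\<forall>C\<in>\<F>. closedin X C) \<and> (\<forall>\<H>. finite \<H> \<and> \<H> \<subseteq> \<F> \<longrightarrow> \<Inter>\<H> \<noteq> {})}"
    have "\<exists>M\<in>FIP. \<forall>\<F>\<in>FIP. M \<subseteq> \<F> \<longrightarrow> \<F> = M"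
    proof (rule subset_Zorn_nonempty)
      have "\<U> \<in> FIP" using \<U> by (simp add: FIP_def)
      then show "FIP \<noteq> {}" by blast
      fix \<C> assume \<C>: "\<C> \<noteq> {}" "subset.chain FIP \<C>"
      then have sub: "B \<in> FIP" if "B \<in> \<C>" for B
        using that by (auto simp: subset.chain_def)
      have "\<Inter>\<H> \<noteq> {}" if \<H>: "finite \<H>" "\<H> \<subseteq> \<Union>\<C>" for \<H>
      proof -
        obtain B where B: "B \<in> \<C>" "\<H> \<subseteq> B"
          using finite_subset_Union_chain[OF \<H> \<C>] by blast
        show ?thesis using sub[OF B(1)] \<H>(1) B(2) by (simp add: FIP_def)
      qed
      moreover have "\<U> \<subseteq> \<Union>\<C>"
      proof -
        obtain B where B: "B \<in> \<C>" using \<C>(1) by blast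
        then have "\<U> \<subseteq> B" using sub by (simp add: FIP_def)
        then show ?thesis using B by blast
      qed
      moreover have "closedin X C" if "C \<in> \<Union>\<C>" for C
        using that sub by (auto simp: FIP_def)
      ultimately show "\<Union>\<C> \<in> FIP" by (simp add: FIP_def)
    qed
    then obtain M where M: "M \<in> FIP" "\<And>\<F>. \<F> \<in> FIP \<Longrightarrow> M \<subseteq> \<F> \<Longrightarrow> \<F> = M" by blast
    have clM: "closedin X C" if "C \<in> M" for C using M(1) that by (auto simp: FIP_def)
    have fip: "\<Inter>\<H> \<noteq> {}" if "finite \<H>" "\<H> \<subseteq> M" for \<H> using M(1) that by (auto simp: FIP_def)
    have add: "C \<in> M" if C: "closedin X C" "\<And>\<H>. \<lbrakk>finite \<H>; \<H> \<subseteq> M\<rbrakk> \<Longrightarrow> C \<inter> \<Inter>\<H> \<noteq> {}" for C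
    proof -
      have "\<Inter>\<H> \<noteq> {}" if \<H>: "finite \<H>" "\<H> \<subseteq> insert C M" for \<H>
      proof -
        have "C \<inter> \<Inter>(\<H> - {C}) \<noteq> {}" using \<H> by (intro C) auto
        then show ?thesis by blast
      qed
      moreover have "\<U> \<subseteq> insert C M" using M(1) by (auto simp: FIP_def)
      ultimately have "insert C M \<in> FIP" using clM C(1) by (simp add: FIP_def)
      then show ?thesis using M(2)[of "insert C M"] by blast
    qed
    have inter: "\<Inter>\<H> \<in> M" if \<H>: "finite \<H>" "\<H> \<subseteq> M" "\<H> \<noteq> {}" for \<H>
    proof (rule add)
      show "closedin X (\<Inter>\<H>)" using \<H> clM by blast
      show "\<Inter>\<H> \<inter> \<Inter>\<H>' \<noteq> {}" if "finite \<H>'" "\<H>' \<subseteq> M" for \<H>'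
        using fip[of "\<H> \<union> \<H>'"] that \<H> by (simp add: Inter_Un_distrib)
    qed
    have disj: "\<exists>D\<in>M. D \<inter> C = {}" if C: "closedin X C" "C \<notin> M" for C
    proof -
      obtain \<H> where \<H>: "finite \<H>" "\<H> \<subseteq> M" "C \<inter> \<Inter>\<H> = {}"
        using add[OF C(1)] C(2) by metis
      have "topspace X \<in> M"
      proof (rule add)
        show "topspace X \<inter> \<Inter>\<H> \<noteq> {}" if \<H>: "finite \<H>" "\<H> \<subseteq> M" for \<H>
        proof (cases "\<H> = {}")
          case False
          then show ?thesis using fip[OF \<H>] clM[THEN closedin_subset] \<H> by blast
        qed (use nonempty in simp)
      qed simp
      then have "\<Inter>(insert (topspace X) \<H>) \<in> M" using \<H> by (intro inter) auto
      moreover have "\<Inter>(insert (topspace X) \<H>) \<inter> C = {}" using \<H>(3) by auto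
      ultimately show ?thesis by blast
    qed
    have meet: "C \<inter> D \<noteq> {}" if "C \<in> M" "D \<in> M" for C D
      using fip[of "{C, D}"] that by simp
    have cinter: "(\<Inter>k. F k) \<in> M" if F: "\<And>k::nat. F k \<in> M" for F
    proof (rule ccontr)
      assume "\<not> ?thesis"
      moreover have "closedin X (\<Inter>k. F k)" using F clM by blast
      ultimately obtain D where D: "D \<in> M" "D \<inter> (\<Inter>k. F k) = {}" using disj by blast
      have "D \<inter> (\<Inter>i\<le>k. F i) \<noteq> {}" for k
        using fip[of "insert D (F ` {..k})"] D F by auto
      then have "\<forall>k. \<exists>y. y \<in> D \<inter> (\<Inter>i\<le>k. F i)" by blast
      from choice[OF this] obtain f where f: "\<And>k. f k \<in> D \<inter> (\<Inter>i\<le>k. F i)" by blast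
      have "f k \<in> topspace X" for k using f[of k] closedin_subset[OF clM[OF D(1)]] by blast
      then have "range f \<subseteq> topspace X" by blast
      then have "\<exists>z\<in>topspace X. \<forall>U. openin X U \<and> z \<in> U \<longrightarrow> infinite {k. f k \<in> U}"
        using acc by (simp add: countably_compact_space_def)
      then obtain z where z: "z \<in> topspace X" "\<And>U. openin X U \<Longrightarrow> z \<in> U \<Longrightarrow> infinite {k. f k \<in> U}"
        by metis
      have zin: "z \<in> C" if C: "closedin X C" "\<And>k. k \<ge> i \<Longrightarrow> f k \<in> C" for C i
      proof (rule ccontr)
        assume "z \<notin> C"
        then have "infinite {k. f k \<in> topspace X - C}" using z C(1) by (intro z(2)) auto
        moreover have "{k. f k \<in> topspace X - C} \<subseteq> {..<i}" using C(2) by (force simp: not_le[symmetric])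
        ultimately show False using finite_subset by blast
      qed
      have "z \<in> D" using f clM[OF D(1)] by (intro zin[of D 0]) auto
      moreover have "z \<in> F k" for k using f clM[OF F] by (intro zin[of "F k" k]) auto
      ultimately show False using D by blast
    qed
    define A where "A n = topspace X - \<Union>(\<G> n)" for n
    have clA: "closedin X (A n)" for n
      unfolding A_def using op by (intro closedin_diff) auto
    \<comment> \<open>\<open>J\<close> collects the indices of the families that cover \<open>Z\<close>.\<close>
    define J where "J = {n. A n \<notin> M}"
    have "\<exists>F\<in>M. (n \<notin> J \<longrightarrow> F = A n) \<and> (n \<in> J \<longrightarrow> F \<inter> A n = {})" for n
      using disj[OF clA] by (cases "n \<in> J") (auto simp: J_def)
    then obtain F where F: "\<And>n. F n \<in> M" "\<And>n. n \<notin> J \<Longrightarrow> F n = A n" "\<And>n. n \<in> J \<Longrightarrow> F n \<inter> A n = {}"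
      by metis
    define Z where "Z = (\<Inter>n. F n)"
    have ZM: "Z \<in> M" unfolding Z_def by (rule cinter[OF F(1)])
    have ZX: "Z \<subseteq> topspace X" using ZM clM closedin_subset by blast
    have cov: "Z \<subseteq> \<Union>(\<G> n)" if "n \<in> J" for n
      using F(3)[OF that] ZX unfolding Z_def A_def by blast
    have uncov: "Z \<inter> \<Union>(\<G> n) = {}" if "n \<notin> J" for n
      using F(2)[OF that] unfolding Z_def A_def by blast
    have opst: "openin X (star x (\<G> n))" for x n
      unfolding star_def using op by blast
    define B where "B n = {y \<in> Z. topspace X - star y (\<G> n) \<in> M}" for n
    have ex: "\<exists>D\<in>M. D \<inter> B n = {}" if n: "n \<in> J" for n
    proof (rule ccontr)
      assume "\<not> ?thesis"
      then have hit: "\<exists>y. y \<in> D \<inter> B n" if "D \<in> M" for D using that by blast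
      define good where "good l y \<longleftrightarrow> y \<in> B n \<and> (\<forall>x\<in>set l. y \<notin> star x (\<G> n))" for l y
      have "\<exists>y. good l y" if l: "set l \<subseteq> B n" for l
      proof -
        have "\<Inter>(insert Z ((\<lambda>x. topspace X - star x (\<G> n)) ` set l)) \<in> M"
          using l ZM by (intro inter) (auto simp: B_def)
        from hit[OF this] show ?thesis by (auto simp: good_def split: if_splits)
      qed
      then obtain c where c: "\<And>l. set l \<subseteq> B n \<Longrightarrow> good l (c l)" by metis
      \<comment> \<open>The list \<open>s k\<close> records the points chosen before stage \<open>k\<close>.\<close>
      define s where "s = rec_nat [] (\<lambda>_ l. c l # l)"
      have s0: "s 0 = []" and sS: "s (Suc k) = c (s k) # s k" for k by (simp_all add: s_def)
      have sB: "set (s k) \<subseteq> B n" for k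
        by (induction k) (use c in \<open>auto simp: s0 sS good_def\<close>)
      define f where "f k = c (s k)" for k
      have fs: "f i \<in> set (s j)" if "i < j" for i j
        using that by (induction j) (auto simp: sS f_def less_Suc_eq)
      have fB: "f k \<in> B n" for k using c[OF sB] by (auto simp: f_def good_def)
      have fsep: "f j \<notin> star (f i) (\<G> n)" if "i < j" for i j
        using c[OF sB, of j] fs[OF that] by (auto simp: f_def good_def)
      have "range f \<subseteq> topspace X" using fB ZX by (auto simp: B_def)
      then have "\<exists>z\<in>topspace X. \<forall>U. openin X U \<and> z \<in> U \<longrightarrow> infinite {k. f k \<in> U}"
        using acc by (simp add: countably_compact_space_def)
      then obtain z where z: "z \<in> topspace X" "\<And>U. openin X U \<Longrightarrow> z \<in> U \<Longrightarrow> infinite {k. f k \<in> U}"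
        by metis
      have "z \<in> Z"
      proof (rule ccontr)
        assume "z \<notin> Z"
        then have "infinite {k. f k \<in> topspace X - Z}" using z clM[OF ZM] by (intro z(2)) auto
        moreover have "{k. f k \<in> topspace X - Z} = {}" using fB by (auto simp: B_def)
        ultimately show False by (metis finite.emptyI)
      qed
      then obtain V where V: "V \<in> \<G> n" "z \<in> V" using cov n by blast
      then have inf: "infinite {k. f k \<in> V}" using z op by blast
      then obtain i where i: "f i \<in> V" by (metis (mono_tags) finite.emptyI Collect_empty_eq)
      obtain j where j: "j > i" "f j \<in> V"
        using inf unfolding infinite_nat_iff_unbounded by blast
      then show False using fsep[OF j(1)] i V(1) unfolding star_def by blast
    qed
    have "\<forall>n. \<exists>D. D \<in> M \<and> (n \<in> J \<longrightarrow> D \<inter> B n = {})"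
    proof
      show "\<exists>D. D \<in> M \<and> (n \<in> J \<longrightarrow> D \<inter> B n = {})" for n
        using ex[of n] ZM by (cases "n \<in> J") auto
    qed
    from choice[OF this] obtain D where "\<forall>n. D n \<in> M \<and> (n \<in> J \<longrightarrow> D n \<inter> B n = {})" ..
    then have D: "D n \<in> M" "n \<in> J \<Longrightarrow> D n \<inter> B n = {}" for n by simp_all
    have "Z \<inter> (\<Inter>n. D n) \<noteq> {}" by (intro meet ZM cinter D(1))
    then obtain p where p: "p \<in> Z" "\<And>n. p \<in> D n" by blast
    have "\<exists>H. H \<in> M \<and> (n \<in> J \<longrightarrow> H \<subseteq> star p (\<G> n))" for n
    proof (cases "n \<in> J")
      case True
      then have "topspace X - star p (\<G> n) \<notin> M" using D(2) p unfolding B_def by blast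
      then obtain H where "H \<in> M" "H \<inter> (topspace X - star p (\<G> n)) = {}"
        using disj[of "topspace X - star p (\<G> n)"] opst by blast
      then show ?thesis using clM closedin_subset by blast
    qed (use ZM in blast)
    then have "\<forall>n. \<exists>H. H \<in> M \<and> (n \<in> J \<longrightarrow> H \<subseteq> star p (\<G> n))" ..
    from choice[OF this] obtain H where "\<forall>n. H n \<in> M \<and> (n \<in> J \<longrightarrow> H n \<subseteq> star p (\<G> n))" ..
    then have H: "H n \<in> M" "n \<in> J \<Longrightarrow> H n \<subseteq> star p (\<G> n)" for n by simp_all
    have Hp: "(\<Inter>n. H n) \<inter> topspace X \<subseteq> {p}"
    proof
      fix x assume x: "x \<in> (\<Inter>n. H n) \<inter> topspace X"
      show "x \<in> {p}"
      proof (rule ccontr)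
        assume "x \<notin> {p}"
        then obtain n where n: "p \<in> star p (\<G> n)" "star p (\<G> n) \<subseteq> topspace X - {x}"
          using sep[of p x] p x ZX by blast
        then have "p \<in> \<Union>(\<G> n)" by (auto simp: star_def)
        then have "n \<in> J" using uncov p by blast
        then show False using H(2) n x by blast
      qed
    qed
    have HM: "(\<Inter>n. H n) \<in> M" by (intro cinter H(1))
    have "p \<in> C" if C: "C \<in> M" for C
    proof -
      obtain w where w: "w \<in> (\<Inter>n. H n)" "w \<in> C" using meet[OF HM C] by blast
      then have "w \<in> topspace X" using closedin_subset[OF clM[OF C]] by blast
      then show ?thesis using w Hp by blast
    qed
    moreover have "\<U> \<subseteq> M" using M(1) by (simp add: FIP_def)
    ultimately have "p \<in> \<Inter>\<U>" by blast
    then show ?thesis by blast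
  qed
qed
section \<open>Suborderable spaces\<close>

lemma linorder_topology_convex_neighbourhood:
  fixes x :: "'c::linorder_topology"
  assumes "open U" "x \<in> U"
  obtains J where "open J" "x \<in> J" "J \<subseteq> U" "\<And>a b. a \<in> J \<Longrightarrow> b \<in> J \<Longrightarrow> {a..b} \<subseteq> J"
proof -
  obtain L where L: "open L" "x \<in> L" "L \<inter> {..x} \<subseteq> U" "\<And>a b. a \<in> L \<Longrightarrow> a \<le> b \<Longrightarrow> b \<in> L"
  proof (cases "\<exists>y. y < x")
    case True
    then obtain b where "b < x" "{b<..x} \<subseteq> U" using open_left assms by blast
    then show thesis by (intro that[of "{b<..}"]) auto
  next
    case False
    then have "y = x" if "y \<le> x" for y using that le_less by metis
    then show thesis using assms by (intro that[of UNIV]) fastforce+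
  qed
  obtain R where R: "open R" "x \<in> R" "R \<inter> {x..} \<subseteq> U" "\<And>a b. b \<in> R \<Longrightarrow> a \<le> b \<Longrightarrow> a \<in> R"
  proof (cases "\<exists>y. y > x")
    case True
    then obtain b where "b > x" "{x..<b} \<subseteq> U" using open_right assms by blast
    then show thesis by (intro that[of "{..<b}"]) auto
  next
    case False
    then have "y = x" if "y \<ge> x" for y using that le_less by metis
    then show thesis using assms by (intro that[of UNIV]) fastforce+
  qed
  show thesis
  proof (rule that[of "L \<inter> R"])
    show "L \<inter> R \<subseteq> U"
    proof
      fix y assume "y \<in> L \<inter> R"
      then show "y \<in> U" using L(3) R(3) by (cases "y \<le> x") auto
    qed
    show "{a..b} \<subseteq> L \<inter> R" if "a \<in> L \<inter> R" "b \<in> L \<inter> R" for a b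
      using that L(4)[of a] R(4)[of b] by auto
  qed (use L R in auto)
qed

definition countable_pi_base_at :: "'a topology \<Rightarrow> 'a \<Rightarrow> bool" where
  "countable_pi_base_at X x \<longleftrightarrow>
     (\<exists>B :: nat \<Rightarrow> 'a set. (\<forall>k. openin X (B k) \<and> B k \<noteq> {}) \<and>
        (\<forall>U. openin X U \<and> x \<in> U \<longrightarrow> (\<exists>k. B k \<subseteq> U)))"

definition P_point :: "'a topology \<Rightarrow> 'a \<Rightarrow> bool" where
  "P_point X x \<longleftrightarrow>
     (\<forall>N :: nat \<Rightarrow> 'a set. (\<forall>k. openin X (N k) \<and> x \<in> N k) \<longrightarrow>
        (\<exists>W. openin X W \<and> x \<in> W \<and> W \<subseteq> (\<Inter>k. N k)))"

text \<open>
If the intersection of the \<open>N k\<close> is not a neighbourhood of \<open>x\<close>, this is already visible on one side of \<open>x\<close>.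
There the ends \<open>b k\<close> of intervals contained in the \<open>N k\<close> converge to \<open>x\<close>, and \<open>S\<close> accumulates at \<open>x\<close>;
so the open intervals between \<open>x\<close> and \<open>b k\<close> form a \<open>\<pi>\<close>-base.
\<close>

lemma suborderable_P_point_or_pi_base:
  fixes S :: "'c::linorder_topology set"
  assumes x: "x \<in> S"
  shows "P_point (top_of_set S) x \<or> countable_pi_base_at (top_of_set S) x"
proof (rule disjCI)
  assume nb: "\<not> countable_pi_base_at (top_of_set S) x"
  show "P_point (top_of_set S) x"
    unfolding P_point_def
  proof (intro allI impI)
    fix N :: "nat \<Rightarrow> 'c set"
    assume N: "\<forall>k. openin (top_of_set S) (N k) \<and> x \<in> N k"
    then have "\<forall>k. \<exists>T. open T \<and> N k = S \<inter> T" by (simp add: openin_open)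
    from choice[OF this] obtain T where T: "\<And>k. open (T k)" "\<And>k. N k = S \<inter> T k" by blast
    then have xT: "x \<in> T k" for k using N by blast
    have "\<exists>R. open R \<and> x \<in> R \<and> S \<inter> R \<inter> {x..} \<subseteq> (\<Inter>k. T k)"
    proof (cases "\<exists>y. y > x")
      case False
      then have "y = x" if "y \<ge> x" for y using that le_less by metis
      then have "S \<inter> UNIV \<inter> {x..} \<subseteq> (\<Inter>k. T k)" using xT by fastforce
      then show ?thesis using open_UNIV by blast
    next
      case True
      then have "\<forall>k. \<exists>b>x. {x..<b} \<subseteq> T k" using open_right T(1) xT by blast
      from choice[OF this] obtain b where b: "\<And>k. b k > x" "\<And>k. {x..<b k} \<subseteq> T k" by blast
      show ?thesis
      proof (rule ccontr)
        assume con: "\<not> ?thesis"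
        have *: "\<exists>s\<in>S. \<exists>k. x < s \<and> s < c \<and> b k \<le> s" if "c > x" for c
        proof -
          have "open {..<c} \<and> x \<in> {..<c}" using that by simp
          then have "\<not> S \<inter> {..<c} \<inter> {x..} \<subseteq> (\<Inter>k. T k)" using con by blast
          then obtain s k where s: "s \<in> S" "s < c" "x \<le> s" "s \<notin> T k" by blast
          then have "s \<notin> {x..<b k}" using b(2) by blast
          then have "b k \<le> s" using s by simp
          then have "x < s" using b(1)[of k] by simp
          then show ?thesis using s \<open>b k \<le> s\<close> by blast
        qed
        have "countable_pi_base_at (top_of_set S) x"
          unfolding countable_pi_base_at_def
        proof (intro exI[of _ "\<lambda>k. S \<inter> {x<..<b k}"] conjI allI impI)
          show "openin (top_of_set S) (S \<inter> {x<..<b k})" for k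
            by (simp add: openin_open_Int)
          show "S \<inter> {x<..<b k} \<noteq> {}" for k using *[OF b(1)[of k]] by auto
          fix U assume "openin (top_of_set S) U \<and> x \<in> U"
          then obtain U' where U': "open U'" "U = S \<inter> U'" "x \<in> U'" by (auto simp: openin_open)
          then obtain c where c: "c > x" "{x..<c} \<subseteq> U'" using open_right True by blast
          then obtain k where "b k < c" using *[OF c(1)] by (meson le_less_trans)
          then have "{x<..<b k} \<subseteq> {x..<c}" by auto
          then have "S \<inter> {x<..<b k} \<subseteq> U" using c U' by blast
          then show "\<exists>k. S \<inter> {x<..<b k} \<subseteq> U" ..
        qed
        then show False using nb by blast
      qed
    qed
    then obtain R where R: "open R" "x \<in> R" "S \<inter> R \<inter> {x..} \<subseteq> (\<Inter>k. T k)" by blast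
    have "\<exists>L. open L \<and> x \<in> L \<and> S \<inter> L \<inter> {..x} \<subseteq> (\<Inter>k. T k)"
    proof (cases "\<exists>y. y < x")
      case False
      then have "y = x" if "y \<le> x" for y using that le_less by metis
      then have "S \<inter> UNIV \<inter> {..x} \<subseteq> (\<Inter>k. T k)" using xT by fastforce
      then show ?thesis using open_UNIV by blast
    next
      case True
      then have "\<forall>k. \<exists>b<x. {b<..x} \<subseteq> T k" using open_left T(1) xT by blast
      from choice[OF this] obtain b where b: "\<And>k. b k < x" "\<And>k. {b k<..x} \<subseteq> T k" by blast
      show ?thesis
      proof (rule ccontr)
        assume con: "\<not> ?thesis"
        have *: "\<exists>s\<in>S. \<exists>k. s < x \<and> c < s \<and> s \<le> b k" if "c < x" for c
        proof -
          have "open {c<..} \<and> x \<in> {c<..}" using that by simp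
          then have "\<not> S \<inter> {c<..} \<inter> {..x} \<subseteq> (\<Inter>k. T k)" using con by blast
          then obtain s k where s: "s \<in> S" "c < s" "s \<le> x" "s \<notin> T k" by blast
          then have "s \<notin> {b k<..x}" using b(2) by blast
          then have "s \<le> b k" using s by simp
          then have "s < x" using b(1)[of k] by simp
          then show ?thesis using s \<open>s \<le> b k\<close> by blast
        qed
        have "countable_pi_base_at (top_of_set S) x"
          unfolding countable_pi_base_at_def
        proof (intro exI[of _ "\<lambda>k. S \<inter> {b k<..<x}"] conjI allI impI)
          show "openin (top_of_set S) (S \<inter> {b k<..<x})" for k
            by (simp add: openin_open_Int)
          show "S \<inter> {b k<..<x} \<noteq> {}" for k using *[OF b(1)[of k]] by auto
          fix U assume "openin (top_of_set S) U \<and> x \<in> U"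
          then obtain U' where U': "open U'" "U = S \<inter> U'" "x \<in> U'" by (auto simp: openin_open)
          then obtain c where c: "c < x" "{c<..x} \<subseteq> U'" using open_left True by blast
          then obtain k where "c < b k" using *[OF c(1)] by (meson less_le_trans)
          then have "{b k<..<x} \<subseteq> {c<..x}" by auto
          then have "S \<inter> {b k<..<x} \<subseteq> U" using c U' by blast
          then show "\<exists>k. S \<inter> {b k<..<x} \<subseteq> U" ..
        qed
        then show False using nb by blast
      qed
    qed
    then obtain L where L: "open L" "x \<in> L" "S \<inter> L \<inter> {..x} \<subseteq> (\<Inter>k. T k)" by blast
    show "\<exists>W. openin (top_of_set S) W \<and> x \<in> W \<and> W \<subseteq> (\<Inter>k. N k)"
    proof (intro exI[of _ "S \<inter> (L \<inter> R)"] conjI)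
      show "openin (top_of_set S) (S \<inter> (L \<inter> R))" using L R by (simp add: openin_open_Int open_Int)
      show "x \<in> S \<inter> (L \<inter> R)" using x L R by simp
      show "S \<inter> (L \<inter> R) \<subseteq> (\<Inter>k. N k)"
      proof
        fix y assume "y \<in> S \<inter> (L \<inter> R)"
        then have "y \<in> (\<Inter>k. S \<inter> T k)" using L(3) R(3) by (cases "y \<le> x") auto
        then show "y \<in> (\<Inter>k. N k)" by (simp add: T(2))
      qed
    qed
  qed
qed

lemma finite_if_pairwise_eq:
  assumes "\<And>x y. x \<in> A \<Longrightarrow> y \<in> A \<Longrightarrow> x = y"
  shows "finite A"
proof (cases "A = {}")
  case False
  then obtain a where "a \<in> A" by blast
  then have "A \<subseteq> {a}" using assms by blast
  then show ?thesis by (rule finite_subset) simp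
qed simp

text \<open>
Let \<open>C d\<close> be the union of the convex open sets whose only point in \<open>D\<close> is \<open>d\<close>. Suppose \<open>U\<close>
is a convex neighbourhood of \<open>x\<close> with at most one point of \<open>D\<close>. If \<open>C d\<close> meets \<open>U\<close>, then some such
convex set \<open>J\<close> meets \<open>U\<close>, and \<open>J \<union> U\<close> contains everything between \<open>d\<close> and \<open>x\<close>. Apart from a point
in \<open>U\<close>, therefore, only the nearest point of \<open>D\<close> on either side of \<open>x\<close> qualifies as \<open>d\<close>.
\<close>

lemma suborderable_expand_discrete:
  fixes S D :: "'c::linorder_topology set"
  assumes D: "D \<subseteq> S"
    and disc: "\<And>x. x \<in> S \<Longrightarrow> \<exists>U. openin (top_of_set S) U \<and> x \<in> U \<and>
                 (\<forall>d\<in>U \<inter> D. \<forall>d'\<in>U \<inter> D. d = d')"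
  shows "\<exists>C. (\<forall>d\<in>D. openin (top_of_set S) (C d) \<and> d \<in> C d) \<and>
    (\<forall>x\<in>S. \<exists>U. openin (top_of_set S) U \<and> x \<in> U \<and> finite {d \<in> D. C d \<inter> U \<noteq> {}})"
proof -
  define conv where "conv J \<longleftrightarrow> open J \<and> (\<forall>a\<in>J. \<forall>b\<in>J. {a..b} \<subseteq> J)" for J :: "'c set"
  have nbh: "\<exists>J. conv J \<and> x \<in> J \<and> (\<forall>d\<in>J \<inter> D. \<forall>d'\<in>J \<inter> D. d = d')" if x: "x \<in> S" for x
  proof -
    obtain U where U: "openin (top_of_set S) U" "x \<in> U" "\<forall>d\<in>U \<inter> D. \<forall>d'\<in>U \<inter> D. d = d'"
      using disc[OF x] by blast
    then obtain T where T: "open T" "U = S \<inter> T" by (auto simp: openin_open)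
    then have "x \<in> T" using U by blast
    then obtain J where J: "open J" "x \<in> J" "J \<subseteq> T" "\<And>a b. a \<in> J \<Longrightarrow> b \<in> J \<Longrightarrow> {a..b} \<subseteq> J"
      using linorder_topology_convex_neighbourhood[OF T(1)] by blast
    have "J \<inter> D \<subseteq> U \<inter> D" using J(3) T(2) D by blast
    then have "\<forall>d\<in>J \<inter> D. \<forall>d'\<in>J \<inter> D. d = d'" using U(3) by (meson subsetD)
    moreover have "conv J" using J(1,4) by (simp add: conv_def)
    ultimately show ?thesis using J(2) by blast
  qed
  define C where "C d = S \<inter> \<Union>{J. conv J \<and> d \<in> J \<and> J \<inter> D \<subseteq> {d}}" for d
  show ?thesis
  proof (rule exI[of _ C], intro conjI[OF ballI ballI])
    fix d assume d: "d \<in> D"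
    then obtain J where J: "conv J" "d \<in> J" "\<forall>d\<in>J \<inter> D. \<forall>d'\<in>J \<inter> D. d = d'"
      using nbh[of d] subsetD[OF D d] by metis
    have "y = d" if "y \<in> J \<inter> D" for y using J(2,3) d that by (metis IntI)
    then have "J \<inter> D \<subseteq> {d}" by blast
    then have "d \<in> C d" using J(1,2) subsetD[OF D d] unfolding C_def by blast
    moreover have "openin (top_of_set S) (C d)"
      unfolding C_def by (intro openin_open_Int open_Union) (auto simp: conv_def)
    ultimately show "openin (top_of_set S) (C d) \<and> d \<in> C d" by blast
  next
    fix x assume x: "x \<in> S"
    then obtain U where U: "conv U" "x \<in> U" "\<forall>d\<in>U \<inter> D. \<forall>d'\<in>U \<inter> D. d = d'"
      using nbh[of x] by metis
    define T where "T = {d \<in> D. C d \<inter> (S \<inter> U) \<noteq> {}}"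
    have T: "\<exists>J w. conv J \<and> d \<in> J \<and> J \<inter> D \<subseteq> {d} \<and> w \<in> J \<and> w \<in> U" if "d \<in> T" for d
      using that unfolding T_def C_def by blast
    have "finite (T \<inter> U)"
    proof (rule finite_if_pairwise_eq)
      show "d = d'" if "d \<in> T \<inter> U" "d' \<in> T \<inter> U" for d d'
        using that U(3) unfolding T_def by blast
    qed
    moreover have "finite {d \<in> T - U. d < x}"
    proof -
      have no: False if dd: "d \<in> T - U" "d' \<in> T - U" "d < d'" "d' < x" for d d'
      proof -
        obtain J w where J: "conv J" "d \<in> J" "J \<inter> D \<subseteq> {d}" "w \<in> J" "w \<in> U"
          using T[of d] dd by blast
        have "d' \<in> J"
        proof (cases "d' \<le> w")
          case True
          then have "d' \<in> {d..w}" using dd by (simp add: not_le less_imp_le)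
          then show ?thesis using J unfolding conv_def by blast
        next
          case False
          then have "d' \<in> {w..x}" using dd by (simp add: not_le less_imp_le)
          then have "d' \<in> U" using U J unfolding conv_def by blast
          then show ?thesis using dd by blast
        qed
        then show False using J(3) dd unfolding T_def by blast
      qed
      show ?thesis
      proof (rule finite_if_pairwise_eq)
        show "d = d'" if "d \<in> {d \<in> T - U. d < x}" "d' \<in> {d \<in> T - U. d < x}" for d d'
          using no[of d d'] no[of d' d] that by (cases d d' rule: linorder_cases) auto
      qed
    qed
    moreover have "finite {d \<in> T - U. x < d}"
    proof -
      have no: False if dd: "d \<in> T - U" "d' \<in> T - U" "d' < d" "x < d'" for d d'
      proof -
        obtain J w where J: "conv J" "d \<in> J" "J \<inter> D \<subseteq> {d}" "w \<in> J" "w \<in> U"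
          using T[of d] dd by blast
        have "d' \<in> J"
        proof (cases "w \<le> d'")
          case True
          then have "d' \<in> {w..d}" using dd by (simp add: not_le less_imp_le)
          then show ?thesis using J unfolding conv_def by blast
        next
          case False
          then have "d' \<in> {x..w}" using dd by (simp add: not_le less_imp_le)
          then have "d' \<in> U" using U J unfolding conv_def by blast
          then show ?thesis using dd by blast
        qed
        then show False using J(3) dd unfolding T_def by blast
      qed
      show ?thesis
      proof (rule finite_if_pairwise_eq)
        show "d = d'" if "d \<in> {d \<in> T - U. x < d}" "d' \<in> {d \<in> T - U. x < d}" for d d'
          using no[of d d'] no[of d' d] that by (cases d d' rule: linorder_cases) auto
      qed
    qed
    moreover have "T \<subseteq> (T \<inter> U) \<union> {d \<in> T - U. d < x} \<union> {d \<in> T - U. x < d}"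
    proof
      show "d \<in> (T \<inter> U) \<union> {d \<in> T - U. d < x} \<union> {d \<in> T - U. x < d}" if "d \<in> T" for d
        using that U(2) by (cases d x rule: linorder_cases) auto
    qed
    ultimately have "finite T" by (meson finite_UnI finite_subset)
    moreover have "openin (top_of_set S) (S \<inter> U)" using U by (simp add: openin_open_Int conv_def)
    ultimately show "\<exists>U. openin (top_of_set S) U \<and> x \<in> U \<and> finite {d \<in> D. C d \<inter> U \<noteq> {}}"
      using U(2) x unfolding T_def by blast
  qed
qed

lemma homeomorphic_P_point:
  assumes hg: "homeomorphic_maps X Y h g" and x: "x \<in> topspace X" and P: "P_point Y (h x)"
  shows "P_point X x"
  unfolding P_point_def
proof (intro allI impI)
  have c: "continuous_map X Y h" "continuous_map Y X g"
    and inv: "\<And>x. x \<in> topspace X \<Longrightarrow> g (h x) = x"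
    using hg unfolding homeomorphic_maps_def by auto
  have hx: "h x \<in> topspace Y" using continuous_map_image_subset_topspace[OF c(1)] x by blast
  fix N :: "nat \<Rightarrow> 'a set" assume N: "\<forall>k. openin X (N k) \<and> x \<in> N k"
  have "\<forall>k. openin Y {y \<in> topspace Y. g y \<in> N k} \<and> h x \<in> {y \<in> topspace Y. g y \<in> N k}"
    using N hx inv[OF x] openin_continuous_map_preimage[OF c(2)] by simp
  then obtain W where W: "openin Y W" "h x \<in> W" "W \<subseteq> (\<Inter>k. {y \<in> topspace Y. g y \<in> N k})"
    using P unfolding P_point_def by meson
  have "openin X {u \<in> topspace X. h u \<in> W}" by (rule openin_continuous_map_preimage[OF c(1) W(1)])
  moreover have "{u \<in> topspace X. h u \<in> W} \<subseteq> (\<Inter>k. N k)"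
  proof (intro subsetI INT_I)
    fix u k assume "u \<in> {u \<in> topspace X. h u \<in> W}"
    then have u: "u \<in> topspace X" "h u \<in> W" by auto
    then have "g (h u) \<in> N k" using W(3) by blast
    then show "u \<in> N k" using inv[OF u(1)] by simp
  qed
  ultimately show "\<exists>W. openin X W \<and> x \<in> W \<and> W \<subseteq> (\<Inter>k. N k)"
    using x W(2) by (intro exI[of _ "{u \<in> topspace X. h u \<in> W}"]) simp
qed

lemma homeomorphic_countable_pi_base_at:
  assumes hg: "homeomorphic_maps X Y h g" and x: "x \<in> topspace X" and P: "countable_pi_base_at Y (h x)"
  shows "countable_pi_base_at X x"
proof -
  have c: "continuous_map X Y h" "continuous_map Y X g"
    and inv: "\<And>x. x \<in> topspace X \<Longrightarrow> g (h x) = x" "\<And>y. y \<in> topspace Y \<Longrightarrow> h (g y) = y"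
    using hg unfolding homeomorphic_maps_def by auto
  have hx: "h x \<in> topspace Y" using continuous_map_image_subset_topspace[OF c(1)] x by blast
  obtain B :: "nat \<Rightarrow> 'b set" where B: "\<forall>k. openin Y (B k) \<and> B k \<noteq> {}"
    "\<forall>U. openin Y U \<and> h x \<in> U \<longrightarrow> (\<exists>k. B k \<subseteq> U)"
    using P unfolding countable_pi_base_at_def by meson
  show ?thesis
    unfolding countable_pi_base_at_def
  proof (intro exI[of _ "\<lambda>k. {u \<in> topspace X. h u \<in> B k}"] conjI allI impI)
    show "openin X {u \<in> topspace X. h u \<in> B k}" for k
      using B(1) by (intro openin_continuous_map_preimage[OF c(1)]) auto
    show "{u \<in> topspace X. h u \<in> B k} \<noteq> {}" for k
    proof -
      obtain y where y: "y \<in> B k" using B(1) by blast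
      then have yY: "y \<in> topspace Y" using B(1) openin_subset by blast
      then have "g y \<in> topspace X" using continuous_map_image_subset_topspace[OF c(2)] by blast
      then have "g y \<in> {u \<in> topspace X. h u \<in> B k}" using y inv(2)[OF yY] by simp
      then show ?thesis by blast
    qed
    fix U assume U: "openin X U \<and> x \<in> U"
    then have "openin Y {y \<in> topspace Y. g y \<in> U}" by (intro openin_continuous_map_preimage[OF c(2)]) auto
    moreover have "h x \<in> {y \<in> topspace Y. g y \<in> U}" using U hx inv(1)[OF x] by simp
    ultimately obtain k where k: "B k \<subseteq> {y \<in> topspace Y. g y \<in> U}" using B(2) by blast
    have "{u \<in> topspace X. h u \<in> B k} \<subseteq> U"
    proof
      fix u assume "u \<in> {u \<in> topspace X. h u \<in> B k}"
      then have u: "u \<in> topspace X" "g (h u) \<in> U" using k by auto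
      then show "u \<in> U" using inv(1)[OF u(1)] by simp
    qed
    then show "\<exists>k. {u \<in> topspace X. h u \<in> B k} \<subseteq> U" ..
  qed
qed

lemma GO_space_P_point_or_pi_base:
  assumes "GO_space TYPE('c::linorder_topology) X" and x: "x \<in> topspace X"
  shows "P_point X x \<or> countable_pi_base_at X x"
proof -
  obtain S :: "'c set" where "X homeomorphic_space top_of_set S"
    using assms(1) unfolding GO_space_def by blast
  then obtain h g where hg: "homeomorphic_maps X (top_of_set S) h g"
    unfolding homeomorphic_space_def by blast
  then have "continuous_map X (top_of_set S) h" by (simp add: homeomorphic_maps_def)
  then have "h x \<in> S" using continuous_map_image_subset_topspace x by fastforce
  then show ?thesis
    using suborderable_P_point_or_pi_base homeomorphic_P_point[OF hg x]
      homeomorphic_countable_pi_base_at[OF hg x] by blast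
qed

lemma GO_space_expand_discrete:
  assumes "GO_space TYPE('c::linorder_topology) X" and D: "D \<subseteq> topspace X"
    and disc: "\<And>x. x \<in> topspace X \<Longrightarrow> \<exists>U. openin X U \<and> x \<in> U \<and> (\<forall>d\<in>U \<inter> D. \<forall>d'\<in>U \<inter> D. d = d')"
  shows "\<exists>C. (\<forall>d\<in>D. openin X (C d) \<and> d \<in> C d) \<and>
    (\<forall>x\<in>topspace X. \<exists>U. openin X U \<and> x \<in> U \<and> finite {d \<in> D. C d \<inter> U \<noteq> {}})"
proof -
  obtain S :: "'c set" where "X homeomorphic_space top_of_set S"
    using assms(1) unfolding GO_space_def by blast
  then obtain h g where hg: "homeomorphic_maps X (top_of_set S) h g"
    unfolding homeomorphic_space_def by blast
  then have c: "continuous_map X (top_of_set S) h" "continuous_map (top_of_set S) X g"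
    and inv: "\<And>x. x \<in> topspace X \<Longrightarrow> g (h x) = x" "\<And>y. y \<in> S \<Longrightarrow> h (g y) = y"
    unfolding homeomorphic_maps_def by auto
  have hS: "h x \<in> S" if "x \<in> topspace X" for x
    using continuous_map_image_subset_topspace[OF c(1)] that by auto
  have gX: "g y \<in> topspace X" if "y \<in> S" for y
    using continuous_map_image_subset_topspace[OF c(2)] that by auto
  have inj: "x = y" if "x \<in> topspace X" "y \<in> topspace X" "h x = h y" for x y
    using inv(1) that by metis
  have pre: "openin (top_of_set S) {y \<in> S. g y \<in> U}" if "openin X U" for U
    using openin_continuous_map_preimage[OF c(2) that] by simp
  have "\<exists>U. openin (top_of_set S) U \<and> y \<in> U \<and> (\<forall>d\<in>U \<inter> h ` D. \<forall>d'\<in>U \<inter> h ` D. d = d')"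
    if y: "y \<in> S" for y
  proof -
    obtain U where U: "openin X U" "g y \<in> U" "\<forall>d\<in>U \<inter> D. \<forall>d'\<in>U \<inter> D. d = d'"
      using disc[OF gX[OF y]] by blast
    have "g a \<in> U \<inter> D \<and> h (g a) = a" if a: "a \<in> {y \<in> S. g y \<in> U} \<inter> h ` D" for a
    proof -
      obtain d where "d \<in> D" "a = h d" using a by blast
      then show ?thesis using a D inv by auto
    qed
    then have "a = b" if "a \<in> {y \<in> S. g y \<in> U} \<inter> h ` D" "b \<in> {y \<in> S. g y \<in> U} \<inter> h ` D" for a b
      using that U(3) by metis
    moreover have "y \<in> {y \<in> S. g y \<in> U}" using y U(2) by simp
    ultimately show ?thesis using pre[OF U(1)] by (intro exI[of _ "{y \<in> S. g y \<in> U}"]) blast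
  qed
  moreover have "h ` D \<subseteq> S" using hS D by blast
  ultimately have "\<exists>C. (\<forall>d\<in>h ` D. openin (top_of_set S) (C d) \<and> d \<in> C d) \<and>
    (\<forall>x\<in>S. \<exists>U. openin (top_of_set S) U \<and> x \<in> U \<and> finite {d \<in> h ` D. C d \<inter> U \<noteq> {}})"
    by (rule suborderable_expand_discrete[rotated])
  then obtain C where C: "\<forall>d\<in>h ` D. openin (top_of_set S) (C d) \<and> d \<in> C d"
    "\<forall>x\<in>S. \<exists>U. openin (top_of_set S) U \<and> x \<in> U \<and> finite {d \<in> h ` D. C d \<inter> U \<noteq> {}}"
    by (elim exE conjE)
  show ?thesis
  proof (rule exI[of _ "\<lambda>d. {x \<in> topspace X. h x \<in> C (h d)}"], intro conjI[OF ballI ballI])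
    show "openin X {x \<in> topspace X. h x \<in> C (h d)} \<and> d \<in> {x \<in> topspace X. h x \<in> C (h d)}"
      if d: "d \<in> D" for d
      using bspec[OF C(1), of "h d"] d D openin_continuous_map_preimage[OF c(1)] by auto
    fix x assume x: "x \<in> topspace X"
    obtain U where U: "openin (top_of_set S) U" "h x \<in> U" "finite {d \<in> h ` D. C d \<inter> U \<noteq> {}}"
      using bspec[OF C(2) hS[OF x]] by blast
    let ?U = "{x \<in> topspace X. h x \<in> U}"
    have "h ` {d \<in> D. {x \<in> topspace X. h x \<in> C (h d)} \<inter> ?U \<noteq> {}} \<subseteq> {d \<in> h ` D. C d \<inter> U \<noteq> {}}"
      by blast
    then have "finite (h ` {d \<in> D. {x \<in> topspace X. h x \<in> C (h d)} \<inter> ?U \<noteq> {}})"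
      using U(3) finite_subset by blast
    moreover have "inj_on h {d \<in> D. {x \<in> topspace X. h x \<in> C (h d)} \<inter> ?U \<noteq> {}}"
      using inj D by (intro inj_onI) blast
    ultimately have "finite {d \<in> D. {x \<in> topspace X. h x \<in> C (h d)} \<inter> ?U \<noteq> {}}"
      by (rule finite_imageD)
    moreover have "openin X ?U" by (rule openin_continuous_map_preimage[OF c(1) U(1)])
    moreover have "x \<in> ?U" using x U(2) by simp
    ultimately show "\<exists>U. openin X U \<and> x \<in> U \<and>
        finite {d \<in> D. {x \<in> topspace X. h x \<in> C (h d)} \<inter> U \<noteq> {}}" by blast
  qed
qed

definition countable_base_at :: "'a topology \<Rightarrow> 'a \<Rightarrow> bool" where
  "countable_base_at X x \<longleftrightarrow>
     (\<exists>V :: nat \<Rightarrow> 'a set. (\<forall>k. openin X (V k) \<and> x \<in> V k) \<and>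
        (\<forall>U. openin X U \<and> x \<in> U \<longrightarrow> (\<exists>k. V k \<subseteq> U)))"

definition rectification :: "'a topology \<Rightarrow> 'a \<Rightarrow> ('a \<Rightarrow> 'a \<Rightarrow> 'a) \<Rightarrow> ('a \<Rightarrow> 'a \<Rightarrow> 'a) \<Rightarrow> bool" where
  "rectification X e p q \<longleftrightarrow>
     e \<in> topspace X \<and>
     continuous_map (prod_topology X X) X (\<lambda>z. p (fst z) (snd z)) \<and>
     continuous_map (prod_topology X X) X (\<lambda>z. q (fst z) (snd z)) \<and>
     (\<forall>x\<in>topspace X. q x x = e) \<and>
     (\<forall>x\<in>topspace X. \<forall>y\<in>topspace X. p x (q x y) = y \<and> q x (p x y) = y)"

lemma rectifiable_space_imp_rectification:
  assumes "rectifiable_space X"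
  obtains e p q where "rectification X e p q"
proof -
  obtain e \<phi> where e: "e \<in> topspace X"
    and \<phi>: "homeomorphic_map (prod_topology X X) (prod_topology X X) \<phi>"
    and fst\<phi>: "\<And>z. z \<in> topspace (prod_topology X X) \<Longrightarrow> fst (\<phi> z) = fst z"
    and diag: "\<And>x. x \<in> topspace X \<Longrightarrow> \<phi> (x, x) = (x, e)"
    using assms unfolding rectifiable_space_def by blast
  obtain \<psi> where \<psi>: "homeomorphic_maps (prod_topology X X) (prod_topology X X) \<phi> \<psi>"
    using \<phi> homeomorphic_map_maps by blast
  have c: "continuous_map (prod_topology X X) (prod_topology X X) \<phi>"
    "continuous_map (prod_topology X X) (prod_topology X X) \<psi>"
    and inv: "\<And>z. z \<in> topspace (prod_topology X X) \<Longrightarrow> \<psi> (\<phi> z) = z"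
    "\<And>z. z \<in> topspace (prod_topology X X) \<Longrightarrow> \<phi> (\<psi> z) = z"
    using \<psi> unfolding homeomorphic_maps_def by auto
  have fst\<psi>: "fst (\<psi> z) = fst z" if z: "z \<in> topspace (prod_topology X X)" for z
  proof -
    have "\<psi> z \<in> topspace (prod_topology X X)"
      using continuous_map_image_subset_topspace[OF c(2)] z by blast
    then show ?thesis using fst\<phi>[of "\<psi> z"] inv(2)[OF z] by simp
  qed
  have "rectification X e (\<lambda>x y. snd (\<psi> (x, y))) (\<lambda>x y. snd (\<phi> (x, y)))"
    unfolding rectification_def
  proof (intro conjI ballI)
    show "continuous_map (prod_topology X X) X (\<lambda>z. snd (\<psi> (fst z, snd z)))"
      "continuous_map (prod_topology X X) X (\<lambda>z. snd (\<phi> (fst z, snd z)))"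
      using continuous_map_compose[OF c(1) continuous_map_snd]
        continuous_map_compose[OF c(2) continuous_map_snd] by (simp_all add: o_def)
    fix x y assume xy: "x \<in> topspace X" "y \<in> topspace X"
    then have z: "(x, y) \<in> topspace (prod_topology X X)" by simp
    have "\<phi> (x, y) = (x, snd (\<phi> (x, y)))" "\<psi> (x, y) = (x, snd (\<psi> (x, y)))"
      using fst\<phi>[OF z] fst\<psi>[OF z] by (simp_all add: prod_eq_iff)
    then show "snd (\<psi> (x, snd (\<phi> (x, y)))) = y" "snd (\<phi> (x, snd (\<psi> (x, y)))) = y"
      using inv[OF z] by (metis snd_conv)+
  qed (use e diag in auto)
  then show thesis by (rule that)
qed

lemma homeomorphic_rectification:
  assumes hg: "homeomorphic_maps X Y h g" and r: "rectification X e p q"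
  shows "rectification Y (h e) (\<lambda>x y. h (p (g x) (g y))) (\<lambda>x y. h (q (g x) (g y)))"
proof -
  have c: "continuous_map X Y h" "continuous_map Y X g"
    and inv: "\<And>x. x \<in> topspace X \<Longrightarrow> g (h x) = x" "\<And>y. y \<in> topspace Y \<Longrightarrow> h (g y) = y"
    using hg unfolding homeomorphic_maps_def by auto
  have e: "e \<in> topspace X"
    and pc: "continuous_map (prod_topology X X) X (\<lambda>z. p (fst z) (snd z))"
    and qc: "continuous_map (prod_topology X X) X (\<lambda>z. q (fst z) (snd z))"
    and diag: "\<And>x. x\<in>topspace X \<Longrightarrow> q x x = e"
    and pq: "\<And>x y. x\<in>topspace X \<Longrightarrow> y\<in>topspace X \<Longrightarrow> p x (q x y) = y"
      "\<And>x y. x\<in>topspace X \<Longrightarrow> y\<in>topspace X \<Longrightarrow> q x (p x y) = y"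
    using r unfolding rectification_def by auto
  have lift: "continuous_map (prod_topology Y Y) Y (\<lambda>z. h (f (g (fst z)) (g (snd z))))"
    if f: "continuous_map (prod_topology X X) X (\<lambda>z. f (fst z) (snd z))" for f
  proof -
    have "continuous_map (prod_topology Y Y) (prod_topology X X) (\<lambda>z. (g (fst z), g (snd z)))"
      using continuous_map_compose[OF continuous_map_fst c(2)]
        continuous_map_compose[OF continuous_map_snd c(2)]
      by (intro continuous_map_pairedI) (simp_all add: o_def)
    from continuous_map_compose[OF continuous_map_compose[OF this f] c(1)] show ?thesis
      by (simp add: o_def)
  qed
  have gX: "g y \<in> topspace X" if "y \<in> topspace Y" for y
    using continuous_map_image_subset_topspace[OF c(2)] that by blast
  have pX: "p x y \<in> topspace X" and qX: "q x y \<in> topspace X"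
    if "x \<in> topspace X" "y \<in> topspace X" for x y
    using continuous_map_image_subset_topspace[OF pc] continuous_map_image_subset_topspace[OF qc] that
    by force+
  show ?thesis
    unfolding rectification_def
    using continuous_map_image_subset_topspace[OF c(1)] e
    by (auto simp: lift[OF pc] lift[OF qc] inv gX pX qX diag pq)
qed

lemma continuous_map_prod_neighbourhood:
  assumes "continuous_map (prod_topology X Y) Z (\<lambda>z. f (fst z) (snd z))"
    and "a \<in> topspace X" "b \<in> topspace Y" "openin Z W" "f a b \<in> W"
  obtains U V where "openin X U" "openin Y V" "a \<in> U" "b \<in> V"
    "\<And>u v. u \<in> U \<Longrightarrow> v \<in> V \<Longrightarrow> f u v \<in> W"
proof -
  define P where "P = {z \<in> topspace (prod_topology X Y). f (fst z) (snd z) \<in> W}"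
  have "openin (prod_topology X Y) P"
    unfolding P_def by (rule openin_continuous_map_preimage[OF assms(1,4)])
  moreover have "(a, b) \<in> P" using assms by (simp add: P_def)
  ultimately have "\<exists>U V. openin X U \<and> openin Y V \<and> a \<in> U \<and> b \<in> V \<and> U \<times> V \<subseteq> P"
    by (simp add: openin_prod_topology_alt)
  then obtain U V where UV: "openin X U" "openin Y V" "a \<in> U" "b \<in> V" "U \<times> V \<subseteq> P" by blast
  have "f u v \<in> W" if "u \<in> U" "v \<in> V" for u v
  proof -
    have "(u, v) \<in> P" using that UV(5) by blast
    then show ?thesis by (simp add: P_def)
  qed
  then show thesis using that UV by blast
qed

lemma continuous_map_sections:
  assumes f: "continuous_map (prod_topology X Y) Z (\<lambda>z. f (fst z) (snd z))"
  shows "a \<in> topspace X \<Longrightarrow> continuous_map Y Z (\<lambda>y. f a y)"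
    and "b \<in> topspace Y \<Longrightarrow> continuous_map X Z (\<lambda>x. f x b)"
proof -
  assume "a \<in> topspace X"
  then have "continuous_map Y (prod_topology X Y) (\<lambda>y. (a, y))"
    by (auto intro!: continuous_map_pairedI)
  from continuous_map_compose[OF this f]
  show "continuous_map Y Z (\<lambda>y. f a y)" by (simp add: o_def)
next
  assume "b \<in> topspace Y"
  then have "continuous_map X (prod_topology X Y) (\<lambda>x. (x, b))"
    by (auto intro!: continuous_map_pairedI)
  from continuous_map_compose[OF this f]
  show "continuous_map X Z (\<lambda>x. f x b)" by (simp add: o_def)
qed

context
  fixes X :: "'a topology" and e p q
  assumes rect: "rectification X e p q"
begin

lemma rect_unit: "e \<in> topspace X"
  and rect_p_cont: "continuous_map (prod_topology X X) X (\<lambda>z. p (fst z) (snd z))"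
  and rect_q_cont: "continuous_map (prod_topology X X) X (\<lambda>z. q (fst z) (snd z))"
  and rect_diag: "x \<in> topspace X \<Longrightarrow> q x x = e"
  and rect_pq: "x \<in> topspace X \<Longrightarrow> y \<in> topspace X \<Longrightarrow> p x (q x y) = y"
  and rect_qp: "x \<in> topspace X \<Longrightarrow> y \<in> topspace X \<Longrightarrow> q x (p x y) = y"
  using rect unfolding rectification_def by auto

lemma rect_q_in: "x \<in> topspace X \<Longrightarrow> y \<in> topspace X \<Longrightarrow> q x y \<in> topspace X"
  using continuous_map_image_subset_topspace[OF rect_q_cont] by force

lemma rect_p_unit: "x \<in> topspace X \<Longrightarrow> p x e = x"
  using rect_pq[of x x] rect_diag[of x] by simp

lemma rect_diagonal_neighbourhood:
  assumes "x \<in> topspace X" "openin X W" "e \<in> W"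
  obtains U where "openin X U" "x \<in> U" "\<And>u v. u \<in> U \<Longrightarrow> v \<in> U \<Longrightarrow> q u v \<in> W"
proof -
  obtain U V where "openin X U" "openin X V" "x \<in> U" "x \<in> V"
    "\<And>u v. u \<in> U \<Longrightarrow> v \<in> V \<Longrightarrow> q u v \<in> W"
    using continuous_map_prod_neighbourhood[OF rect_q_cont assms(1,1,2)] assms(3)
      rect_diag[OF assms(1)] by metis
  then show thesis by (intro that[of "U \<inter> V"]) auto
qed

lemma pi_base_imp_countable_base_at_unit:
  assumes x: "x \<in> topspace X" and pi: "countable_pi_base_at X x"
  shows "countable_base_at X e"
proof -
  obtain B :: "nat \<Rightarrow> 'a set" where B: "\<And>k. openin X (B k)" "\<And>k. B k \<noteq> {}"
    "\<And>U. openin X U \<Longrightarrow> x \<in> U \<Longrightarrow> \<exists>k. B k \<subseteq> U"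
    using pi unfolding countable_pi_base_at_def by metis
  have "\<forall>k. \<exists>y. y \<in> B k" using B(2) by blast
  from choice[OF this] obtain b where b: "\<And>k. b k \<in> B k" by blast
  then have bX: "b k \<in> topspace X" for k using openin_subset[OF B(1)] by blast
  show ?thesis
    unfolding countable_base_at_def
  proof (intro exI[of _ "\<lambda>k. {w \<in> topspace X. p (b k) w \<in> B k}"] conjI allI impI)
    show "openin X {w \<in> topspace X. p (b k) w \<in> B k}" for k
      by (rule openin_continuous_map_preimage[OF continuous_map_sections(1)[OF rect_p_cont bX] B(1)])
    show "e \<in> {w \<in> topspace X. p (b k) w \<in> B k}" for k
      using rect_unit rect_p_unit[OF bX] b by simp
    fix W assume "openin X W \<and> e \<in> W"
    then have W: "openin X W" "e \<in> W" by auto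
    obtain U where U: "openin X U" "x \<in> U" "\<And>u v. u \<in> U \<Longrightarrow> v \<in> U \<Longrightarrow> q u v \<in> W"
      using rect_diagonal_neighbourhood[OF x W] by blast
    obtain k where k: "B k \<subseteq> U" using B(3)[OF U(1,2)] by blast
    have "w \<in> W" if w: "w \<in> topspace X" "p (b k) w \<in> B k" for w
    proof -
      have "q (b k) (p (b k) w) \<in> W" using U(3) k b w(2) by blast
      then show ?thesis using rect_qp[OF bX w(1)] by simp
    qed
    then show "\<exists>k. {w \<in> topspace X. p (b k) w \<in> B k} \<subseteq> W" by blast
  qed
qed

lemma rect_locally_compact_if_somewhere:
  assumes U: "openin X U" "x0 \<in> U" "U \<subseteq> K" "compactin X K"
  shows "locally_compact_space X"
  unfolding locally_compact_space_def
proof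
  fix x assume x: "x \<in> topspace X"
  have x0: "x0 \<in> topspace X" using U openin_subset by blast
  define h where "h y = p x0 (q x y)" for y
  define g where "g y = p x (q x0 y)" for y
  have ch: "continuous_map X X h"
    unfolding h_def using continuous_map_compose[OF continuous_map_sections(1)[OF rect_q_cont x]
      continuous_map_sections(1)[OF rect_p_cont x0]] by (simp add: o_def)
  have cg: "continuous_map X X g"
    unfolding g_def using continuous_map_compose[OF continuous_map_sections(1)[OF rect_q_cont x0]
      continuous_map_sections(1)[OF rect_p_cont x]] by (simp add: o_def)
  have gh: "g (h y) = y" if "y \<in> topspace X" for y
    using that x x0 by (simp add: g_def h_def rect_qp rect_pq rect_q_in)
  have hx: "h x = x0" using x x0 by (simp add: h_def rect_diag rect_p_unit)
  show "\<exists>U K. openin X U \<and> compactin X K \<and> x \<in> U \<and> U \<subseteq> K"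
  proof (intro exI conjI)
    show "openin X {y \<in> topspace X. h y \<in> U}" by (rule openin_continuous_map_preimage[OF ch U(1)])
    show "compactin X (g ` K)" by (rule image_compactin[OF U(4) cg])
    show "x \<in> {y \<in> topspace X. h y \<in> U}" using x hx U by simp
    show "{y \<in> topspace X. h y \<in> U} \<subseteq> g ` K"
    proof
      fix y assume "y \<in> {y \<in> topspace X. h y \<in> U}"
      then have "y = g (h y)" "h y \<in> K" using gh U(3) by auto
      then show "y \<in> g ` K" by blast
    qed
  qed
qed

lemma rect_second_countable:
  assumes base: "countable_base_at X e"
    and ctble: "\<And>D. D \<subseteq> topspace X \<Longrightarrow>
        (\<And>x. x \<in> topspace X \<Longrightarrow> \<exists>U. openin X U \<and> x \<in> U \<and> (\<forall>d\<in>U \<inter> D. \<forall>d'\<in>U \<inter> D. d = d')) \<Longrightarrow> countable D"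
  shows "second_countable X"
proof -
  obtain V :: "nat \<Rightarrow> 'a set" where "\<forall>k. openin X (V k) \<and> e \<in> V k"
    "\<forall>W. openin X W \<and> e \<in> W \<longrightarrow> (\<exists>k. V k \<subseteq> W)"
    using base unfolding countable_base_at_def by (elim exE conjE)
  then have V: "openin X (V k)" "e \<in> V k" "openin X W \<Longrightarrow> e \<in> W \<Longrightarrow> \<exists>k. V k \<subseteq> W" for k W
    by simp_all
  have "\<exists>D. countable D \<and> D \<subseteq> topspace X \<and> (\<forall>x\<in>topspace X. \<exists>d\<in>D. q x d \<in> V n)" for n
  proof -
    define \<D> where "\<D> = {D. D \<subseteq> topspace X \<and> (\<forall>d\<in>D. \<forall>d'\<in>D. d \<noteq> d' \<longrightarrow> \<not> (q d d' \<in> V n \<and> q d' d \<in> V n))}"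
    have "\<exists>D\<in>\<D>. \<forall>D'\<in>\<D>. D \<subseteq> D' \<longrightarrow> D' = D"
    proof (rule subset_Zorn')
      fix \<C> assume \<C>: "subset.chain \<D> \<C>"
      show "\<Union>\<C> \<in> \<D>"
        unfolding \<D>_def mem_Collect_eq
      proof (intro conjI ballI impI)
        show "\<Union>\<C> \<subseteq> topspace X" using \<C> unfolding subset.chain_def \<D>_def by blast
        fix d d' assume d: "d \<in> \<Union>\<C>" "d' \<in> \<Union>\<C>" "d \<noteq> d'"
        then obtain C C' where C: "C \<in> \<C>" "d \<in> C" "C' \<in> \<C>" "d' \<in> C'" by blast
        then have "C \<subseteq> C' \<or> C' \<subseteq> C" using \<C> by (meson subset_chain_def)
        then obtain C'' where "C'' \<in> \<C>" "d \<in> C''" "d' \<in> C''" using C by blast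
        moreover have "C'' \<in> \<D>" using \<C> \<open>C'' \<in> \<C>\<close> unfolding subset.chain_def by blast
        ultimately show "\<not> (q d d' \<in> V n \<and> q d' d \<in> V n)" using d(3) unfolding \<D>_def by blast
      qed
    qed
    then obtain D where D: "D \<in> \<D>" "\<And>D'. D' \<in> \<D> \<Longrightarrow> D \<subseteq> D' \<Longrightarrow> D' = D" by blast
    have DX: "D \<subseteq> topspace X" using D(1) by (simp add: \<D>_def)
    have Dsep: "\<not> (q d d' \<in> V n \<and> q d' d \<in> V n)" if "d \<in> D" "d' \<in> D" "d \<noteq> d'" for d d'
      using D(1) that by (simp add: \<D>_def)
    have "countable D"
    proof (rule ctble[OF DX])
      fix x assume "x \<in> topspace X"
      then obtain U where U: "openin X U" "x \<in> U" "\<And>u v. u \<in> U \<Longrightarrow> v \<in> U \<Longrightarrow> q u v \<in> V n"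
        using rect_diagonal_neighbourhood V(1,2) by metis
      have "d = d'" if "d \<in> U \<inter> D" "d' \<in> U \<inter> D" for d d'
        using that U(3) Dsep by blast
      then show "\<exists>U. openin X U \<and> x \<in> U \<and> (\<forall>d\<in>U \<inter> D. \<forall>d'\<in>U \<inter> D. d = d')" using U(1,2) by blast
    qed
    moreover have "\<exists>d\<in>D. q x d \<in> V n" if x: "x \<in> topspace X" for x
    proof (cases "x \<in> D")
      case True
      then show ?thesis using rect_diag[OF x] V(2) by (intro bexI[of _ x]) auto
    next
      case False
      then have "insert x D \<notin> \<D>" using D(2)[of "insert x D"] by blast
      moreover have "insert x D \<subseteq> topspace X" using x DX by simp
      ultimately obtain a b where ab: "a \<in> insert x D" "b \<in> insert x D" "a \<noteq> b" "q a b \<in> V n" "q b a \<in> V n"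
        unfolding \<D>_def by blast
      then have "a = x \<and> b \<in> D \<or> b = x \<and> a \<in> D" using Dsep by blast
      then show ?thesis using ab by blast
    qed
    ultimately show ?thesis using DX by blast
  qed
  then have "\<forall>n. \<exists>D. countable D \<and> D \<subseteq> topspace X \<and> (\<forall>x\<in>topspace X. \<exists>d\<in>D. q x d \<in> V n)" ..
  from choice[OF this] obtain D
    where D: "\<forall>n. countable (D n) \<and> D n \<subseteq> topspace X \<and> (\<forall>x\<in>topspace X. \<exists>d\<in>D n. q x d \<in> V n)" ..
  define E where "E = (\<Union>n. D n)"
  have E: "countable E" "E \<subseteq> topspace X" using D by (auto simp: E_def)
  have dense: "\<exists>d\<in>E. d \<in> U" if U: "openin X U" "x \<in> U" for x U
  proof -
    have x: "x \<in> topspace X" using U openin_subset by blast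
    obtain U' W where W: "openin X W" "e \<in> W" "x \<in> U'" "\<And>u w. u \<in> U' \<Longrightarrow> w \<in> W \<Longrightarrow> p u w \<in> U"
      using continuous_map_prod_neighbourhood[OF rect_p_cont x rect_unit U(1)] U(2) rect_p_unit[OF x]
      by metis
    obtain n where n: "V n \<subseteq> W" using V(3)[OF W(1,2)] by blast
    obtain d where d: "d \<in> D n" "q x d \<in> V n" using D x by blast
    then have dX: "d \<in> topspace X" using D by blast
    have "p x (q x d) \<in> U" using W(3,4) d(2) n by blast
    then have "d \<in> U" using rect_pq[OF x dX] by simp
    then show ?thesis using d(1) by (auto simp: E_def)
  qed
  show ?thesis
    unfolding second_countable_def
  proof (intro exI[of _ "(\<lambda>(d, m). {y \<in> topspace X. q d y \<in> V m}) ` (E \<times> UNIV)"] conjI ballI allI impI)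
    show "countable ((\<lambda>(d, m). {y \<in> topspace X. q d y \<in> V m}) ` (E \<times> UNIV))"
      using E(1) by (intro countable_image countable_SIGMA) auto
    show "openin X B" if B: "B \<in> (\<lambda>(d, m). {y \<in> topspace X. q d y \<in> V m}) ` (E \<times> UNIV)" for B
    proof -
      obtain d m where dm: "d \<in> E" "B = {y \<in> topspace X. q d y \<in> V m}" using B by auto
      then have "d \<in> topspace X" using E by blast
      then show ?thesis unfolding dm(2)
        by (intro openin_continuous_map_preimage[OF continuous_map_sections(1)[OF rect_q_cont] V(1)])
    qed
    fix O' x assume O': "openin X O' \<and> x \<in> O'"
    then have x: "x \<in> topspace X" using openin_subset by blast
    have O1: "openin X O'" "x \<in> O'" using O' by auto
    obtain U W where W: "openin X U" "openin X W" "x \<in> U" "e \<in> W" "\<And>u w. u \<in> U \<Longrightarrow> w \<in> W \<Longrightarrow> p u w \<in> O'"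
      using continuous_map_prod_neighbourhood[OF rect_p_cont x rect_unit O1(1)] O1(2) rect_p_unit[OF x]
      by metis
    obtain m where m: "V m \<subseteq> W" using V(3)[OF W(2,4)] by blast
    have "openin X {d \<in> topspace X. q d x \<in> V m}"
      by (rule openin_continuous_map_preimage[OF continuous_map_sections(2)[OF rect_q_cont x] V(1)])
    then have "openin X (U \<inter> {d \<in> topspace X. q d x \<in> V m})" using W(1) by blast
    moreover have "x \<in> U \<inter> {d \<in> topspace X. q d x \<in> V m}" using W(3) x rect_diag[OF x] V(2) by simp
    ultimately obtain d where d: "d \<in> E" "d \<in> U" "q d x \<in> V m" using dense by blast
    have dX: "d \<in> topspace X" using d E by blast
    have "y \<in> O'" if y: "y \<in> topspace X" "q d y \<in> V m" for y
    proof -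
      have "p d (q d y) \<in> O'" using W(5) d(2) y(2) m by blast
      then show ?thesis using rect_pq[OF dX y(1)] by simp
    qed
    then have "x \<in> {y \<in> topspace X. q d y \<in> V m} \<and> {y \<in> topspace X. q d y \<in> V m} \<subseteq> O'"
      using x d by blast
    then show "\<exists>B\<in>(\<lambda>(d, m). {y \<in> topspace X. q d y \<in> V m}) ` (E \<times> UNIV). x \<in> B \<and> B \<subseteq> O'"
      using d(1) by (intro bexI[of _ "{y \<in> topspace X. q d y \<in> V m}"]) auto
  qed
qed

end
lemma compact_space_infinite_family_accumulates:
  assumes X: "compact_space X" and D: "infinite D" "\<And>d. d \<in> D \<Longrightarrow> f d \<in> topspace X"
  obtains z where "z \<in> topspace X" "\<And>U. \<lbrakk>openin X U; z \<in> U\<rbrakk> \<Longrightarrow> infinite {d \<in> D. f d \<in> U}"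
proof (rule ccontr)
  assume "\<not> thesis"
  then have no: "\<exists>U. openin X U \<and> z \<in> U \<and> finite {d \<in> D. f d \<in> U}" if "z \<in> topspace X" for z
    using that \<open>\<And>z. \<lbrakk>z \<in> topspace X; \<And>U. \<lbrakk>openin X U; z \<in> U\<rbrakk> \<Longrightarrow> infinite {d \<in> D. f d \<in> U}\<rbrakk> \<Longrightarrow> thesis\<close>
    by blast
  define \<U> where "\<U> = {U. openin X U \<and> finite {d \<in> D. f d \<in> U}}"
  have "topspace X \<subseteq> \<Union>\<U>"
  proof
    show "z \<in> \<Union>\<U>" if "z \<in> topspace X" for z using no[OF that] by (auto simp: \<U>_def)
  qed
  then obtain \<V> where \<V>: "finite \<V>" "\<V> \<subseteq> \<U>" "topspace X \<subseteq> \<Union>\<V>"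
    using compactinD[of X "topspace X" \<U>] X by (auto simp: compact_space_def \<U>_def)
  have "finite (\<Union>U\<in>\<V>. {d \<in> D. f d \<in> U})" using \<V>(1,2) by (auto simp: \<U>_def)
  moreover have "D \<subseteq> (\<Union>U\<in>\<V>. {d \<in> D. f d \<in> U})" using D(2) \<V>(3) by blast
  ultimately show False using D(1) finite_subset by blast
qed

lemma dense_meets_open:
  assumes "X closure_of S = topspace X" "openin X U" "x \<in> U"
  obtains y where "y \<in> S" "y \<in> U"
  using assms(1)[unfolded dense_intersects_open] assms(2,3) that by (metis disjoint_iff emptyE)

lemma regular_space_closed_neighbourhood:
  assumes "regular_space X" "openin X W" "x \<in> W"
  obtains U C where "openin X U" "closedin X C" "x \<in> U" "U \<subseteq> C" "C \<subseteq> W"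
  using assms unfolding neighbourhood_base_of_closedin[symmetric] neighbourhood_base_of by meson

lemma remainder_of_P_points_not_locally_quasi_G_delta_diagonal:
  assumes X: "compact_space X" "Hausdorff_space X" "topspace X \<noteq> {}"
    and H: "H \<subseteq> topspace X" "X closure_of H = topspace X"
    and Y: "Y = topspace X - H" "X closure_of Y = topspace X"
    and P: "\<And>x. x \<in> H \<Longrightarrow> P_point (subtopology X H) x"
    and loc: "has_locally quasi_G_delta_diagonal (subtopology X Y)"
  shows False
proof -
  have reg: "regular_space X" by (rule compact_Hausdorff_imp_regular_space[OF X(1,2)])
  obtain x0 where "x0 \<in> topspace X" using X(3) by blast
  then obtain y where y: "y \<in> Y" using dense_meets_open[OF Y(2) openin_topspace] by blast
  then have yY: "y \<in> topspace (subtopology X Y)" using Y(1) by simp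
  obtain U V where UV: "openin (subtopology X Y) U" "y \<in> U" "U \<subseteq> V" "V \<subseteq> topspace (subtopology X Y)"
    and qV: "quasi_G_delta_diagonal (subtopology (subtopology X Y) V)"
    by (rule has_locally_neighbourhood[OF loc yY])
  obtain T where T: "openin X T" "U = T \<inter> Y" using UV(1) by (auto simp: openin_subtopology)
  then have "y \<in> T" using UV(2) by blast
  then obtain O' C where O': "openin X O'" "closedin X C" "y \<in> O'" "O' \<subseteq> C" "C \<subseteq> T"
    using regular_space_closed_neighbourhood[OF reg T(1)] by blast
  define N where "N = C \<inter> Y"
  have NV: "N \<subseteq> V" "N \<subseteq> Y" using O'(5) T(2) UV(3) by (auto simp: N_def)
  have "Y \<inter> (V \<inter> N) = N" using NV by blast
  then have "subtopology (subtopology (subtopology X Y) V) N = subtopology X N"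
    by (simp add: subtopology_subtopology Int_assoc)
  then have qN: "quasi_G_delta_diagonal (subtopology X N)"
    using quasi_G_delta_diagonal_subtopology[OF qV, of N] by simp
  have acc: "countably_compact_space (subtopology X N)"
    unfolding countably_compact_space_def
  proof (intro allI impI)
    fix f :: "nat \<Rightarrow> 'a" assume "range f \<subseteq> topspace (subtopology X N)"
    then have f: "f k \<in> topspace X" "f k \<in> N" for k by (auto simp: image_subset_iff)
    obtain z where z: "z \<in> topspace X" "\<And>U. \<lbrakk>openin X U; z \<in> U\<rbrakk> \<Longrightarrow> infinite {k \<in> UNIV. f k \<in> U}"
      using compact_space_infinite_family_accumulates[OF X(1), of "UNIV :: nat set" f] f(1) by blast
    have "z \<in> C"
    proof (rule ccontr)
      assume "z \<notin> C"
      then have "infinite {k \<in> UNIV. f k \<in> topspace X - C}" using z(1) O'(2) by (intro z(2)) auto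
      moreover have "{k \<in> UNIV. f k \<in> topspace X - C} = {}" using f(2) by (auto simp: N_def)
      ultimately show False by (metis finite.emptyI)
    qed
    moreover have "z \<in> Y"
    proof (rule ccontr)
      assume "z \<notin> Y"
      then have zH: "z \<in> H" using z(1) Y(1) by blast
      have "\<exists>A B. openin X A \<and> openin X B \<and> z \<in> A \<and> f k \<in> B \<and> A \<inter> B = {}" for k
      proof -
        have "z \<noteq> f k" using \<open>z \<notin> Y\<close> f(2)[of k] NV(2) by blast
        then show ?thesis
          using X(2) z(1) f(1)[of k] unfolding Hausdorff_space_def disjnt_def by blast
      qed
      then have "\<forall>k. \<exists>A B. openin X A \<and> openin X B \<and> z \<in> A \<and> f k \<in> B \<and> A \<inter> B = {}" ..
      from choice[OF this] obtain A
        where "\<forall>k. \<exists>B. openin X (A k) \<and> openin X B \<and> z \<in> A k \<and> f k \<in> B \<and> A k \<inter> B = {}" ..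
      from choice[OF this] obtain B
        where AB: "\<forall>k. openin X (A k) \<and> openin X (B k) \<and> z \<in> A k \<and> f k \<in> B k \<and> A k \<inter> B k = {}" ..
      have "\<forall>k. openin (subtopology X H) (A k \<inter> H) \<and> z \<in> A k \<inter> H"
        using AB zH by (auto simp: openin_subtopology)
      then obtain W where W: "openin (subtopology X H) W" "z \<in> W" "W \<subseteq> (\<Inter>k. A k \<inter> H)"
        using P[OF zH] unfolding P_point_def by meson
      then obtain W' where W': "openin X W'" "W = W' \<inter> H" by (auto simp: openin_subtopology)
      have "f k \<notin> W'" for k
      proof
        assume "f k \<in> W'"
        then have "openin X (W' \<inter> B k)" "f k \<in> W' \<inter> B k" using W'(1) AB by auto
        then obtain h where h: "h \<in> H" "h \<in> W' \<inter> B k" using dense_meets_open[OF H(2)] by blast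
        then have "h \<in> A k" using W(3) W'(2) by blast
        then show False using h(2) AB by blast
      qed
      then have "{k \<in> UNIV. f k \<in> W'} = {}" by blast
      moreover have "infinite {k \<in> UNIV. f k \<in> W'}" using W(2) W' by (intro z(2)) auto
      ultimately show False by (metis finite.emptyI)
    qed
    ultimately have zN: "z \<in> N" by (simp add: N_def)
    have "infinite {k. f k \<in> U}" if U: "openin (subtopology X N) U" "z \<in> U" for U
    proof -
      obtain U' where U': "openin X U'" "U = U' \<inter> N" using U(1) by (auto simp: openin_subtopology)
      then have "{k. f k \<in> U} = {k \<in> UNIV. f k \<in> U'}" using f(2) by blast
      moreover have "infinite {k \<in> UNIV. f k \<in> U'}" using U' U(2) by (intro z(2)) auto
      ultimately show ?thesis by metis
    qed
    then show "\<exists>z\<in>topspace (subtopology X N). \<forall>U. openin (subtopology X N) U \<and> z \<in> U \<longrightarrow> infinite {k. f k \<in> U}"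
      using z(1) zN by (intro bexI[of _ z]) auto
  qed
  have "compact_space (subtopology X N)"
    by (rule countably_compact_quasi_G_delta_diagonal_imp_compact[OF acc qN])
  then have "compactin X N" using NV(2) Y(1) by (auto simp: compactin_subspace)
  then have "closedin X N" using X(2) compactin_imp_closedin by blast
  then have opd: "openin X (O' - N)" using O'(1) by (rule openin_diff[rotated])
  have "O' - N = {}"
  proof (rule ccontr)
    assume "O' - N \<noteq> {}"
    then obtain x where "x \<in> O' - N" by blast
    then obtain u where "u \<in> Y" "u \<in> O' - N" using dense_meets_open[OF Y(2) opd] by blast
    then show False using O'(4) by (auto simp: N_def)
  qed
  obtain h where "h \<in> H" "h \<in> O'" using dense_meets_open[OF H(2) O'(1,3)] by blast
  then show False using \<open>O' - N = {}\<close> NV(2) Y(1) by blast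
qed

lemma locally_finite_open_expansion_countable:
  assumes X: "compact_space X" "Hausdorff_space X"
    and H: "H \<subseteq> topspace X" "X closure_of H = topspace X"
    and Y: "Y = topspace X - H" "X closure_of Y = topspace X"
    and loc: "has_locally quasi_G_delta_diagonal (subtopology X Y)"
    and D: "D \<subseteq> H"
    and C: "\<And>d. d \<in> D \<Longrightarrow> openin (subtopology X H) (C d) \<and> d \<in> C d"
    and lf: "\<And>x. x \<in> H \<Longrightarrow> \<exists>U. openin (subtopology X H) U \<and> x \<in> U \<and> finite {d \<in> D. C d \<inter> U \<noteq> {}}"
  shows "countable D"
proof -
  have "\<forall>d\<in>D. \<exists>T. openin X T \<and> C d = T \<inter> H" using C by (auto simp: openin_subtopology)
  from bchoice[OF this] obtain T where T: "\<forall>d\<in>D. openin X (T d) \<and> C d = T d \<inter> H" ..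
  define F where "F = {z \<in> topspace X. \<forall>U. openin X U \<and> z \<in> U \<longrightarrow> infinite {d \<in> D. T d \<inter> U \<noteq> {}}}"
  have FH: "F \<inter> H = {}"
  proof (rule ccontr)
    assume "F \<inter> H \<noteq> {}"
    then obtain x where x: "x \<in> F" "x \<in> H" by blast
    then obtain U where U: "openin (subtopology X H) U" "x \<in> U" "finite {d \<in> D. C d \<inter> U \<noteq> {}}"
      using lf by blast
    obtain U' where U': "openin X U'" "U = U' \<inter> H" using U(1) by (auto simp: openin_subtopology)
    have "{d \<in> D. T d \<inter> U' \<noteq> {}} \<subseteq> {d \<in> D. C d \<inter> U \<noteq> {}}"
    proof (intro subsetI CollectI conjI)
      fix d assume "d \<in> {d \<in> D. T d \<inter> U' \<noteq> {}}"
      then obtain w where w: "d \<in> D" "w \<in> T d \<inter> U'" by blast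
      then show "d \<in> D" by blast
      have "openin X (T d \<inter> U')" using T w(1) U'(1) by blast
      then obtain h where "h \<in> H" "h \<in> T d \<inter> U'" using dense_meets_open[OF H(2) _ w(2)] by blast
      then show "C d \<inter> U \<noteq> {}" using T w(1) U'(2) by blast
    qed
    then have "finite {d \<in> D. T d \<inter> U' \<noteq> {}}" using U(3) finite_subset by blast
    moreover have "x \<in> U'" using U(2) U'(2) by blast
    ultimately show False using x(1) U'(1) unfolding F_def by blast
  qed
  have clF: "closedin X F"
  proof -
    have "openin X (topspace X - F)"
    proof (subst openin_subopen, intro ballI)
      fix z assume z: "z \<in> topspace X - F"
      then obtain U where U: "openin X U" "z \<in> U" "finite {d \<in> D. T d \<inter> U \<noteq> {}}"
        unfolding F_def by blast
      then have "U \<subseteq> topspace X - F" using openin_subset[OF U(1)] unfolding F_def by blast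
      then show "\<exists>T. openin X T \<and> z \<in> T \<and> T \<subseteq> topspace X - F" using U by blast
    qed
    then show ?thesis unfolding closedin_def F_def by blast
  qed
  have FY: "F \<subseteq> Y" using FH Y(1) unfolding F_def by blast
  have "compactin X F" by (rule closedin_compact_space[OF X(1) clF])
  then have cF: "compactin (subtopology X Y) F" using FY by (simp add: compactin_subtopology)
  have hY: "Hausdorff_space (subtopology X Y)" by (rule Hausdorff_space_subtopology[OF X(2)])
  obtain \<O> where \<O>: "countable \<O>" "\<And>O'. O' \<in> \<O> \<Longrightarrow> openin (subtopology X Y) O' \<and> F \<subseteq> O'"
    "\<And>x. x \<in> topspace (subtopology X Y) - F \<Longrightarrow> \<exists>O'\<in>\<O>. x \<notin> O'"
    using compact_in_locally_quasi_G_delta_diagonal_is_G_delta[OF hY loc cF] by blast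
  have "\<exists>y. y \<in> Y \<and> y \<in> T d \<and> y \<notin> F" if d: "d \<in> D" for d
  proof -
    have "openin X (T d - F)" using T d clF by blast
    moreover have "d \<in> T d - F" using C[OF d] T d D FH by blast
    ultimately obtain y where "y \<in> Y" "y \<in> T d - F" using dense_meets_open[OF Y(2)] by blast
    then show ?thesis by blast
  qed
  then have "\<forall>d\<in>D. \<exists>y. y \<in> Y \<and> y \<in> T d \<and> y \<notin> F" ..
  from bchoice[OF this] obtain y where y: "\<forall>d\<in>D. y d \<in> Y \<and> y d \<in> T d \<and> y d \<notin> F" ..
  have fin: "finite {d \<in> D. y d \<notin> O'}" if O': "O' \<in> \<O>" for O'
  proof (rule ccontr)
    assume inf: "infinite {d \<in> D. y d \<notin> O'}"
    have "y d \<in> topspace X" if "d \<in> {d \<in> D. y d \<notin> O'}" for d using that y Y(1) by blast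
    then obtain z where z: "z \<in> topspace X"
      "\<And>U. \<lbrakk>openin X U; z \<in> U\<rbrakk> \<Longrightarrow> infinite {d \<in> {d \<in> D. y d \<notin> O'}. y d \<in> U}"
      using compact_space_infinite_family_accumulates[OF X(1) inf] by blast
    have "infinite {d \<in> D. T d \<inter> U \<noteq> {}}" if "openin X U" "z \<in> U" for U
    proof -
      have "{d \<in> {d \<in> D. y d \<notin> O'}. y d \<in> U} \<subseteq> {d \<in> D. T d \<inter> U \<noteq> {}}" using y by blast
      then show ?thesis using z(2)[OF that] finite_subset by blast
    qed
    then have "z \<in> F" using z(1) unfolding F_def by blast
    then have "z \<in> O'" using \<O>(2)[OF O'] by blast
    obtain W where W: "openin X W" "O' = W \<inter> Y" using \<O>(2)[OF O'] by (auto simp: openin_subtopology)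
    have "{d \<in> {d \<in> D. y d \<notin> O'}. y d \<in> W} = {}" using y W(2) by blast
    moreover have "infinite {d \<in> {d \<in> D. y d \<notin> O'}. y d \<in> W}"
      using W \<open>z \<in> O'\<close> by (intro z(2)) auto
    ultimately show False by (metis finite.emptyI)
  qed
  have "D \<subseteq> (\<Union>O'\<in>\<O>. {d \<in> D. y d \<notin> O'})"
  proof
    fix d assume d: "d \<in> D"
    then have "y d \<in> topspace (subtopology X Y) - F" using y Y(1) by auto
    then show "d \<in> (\<Union>O'\<in>\<O>. {d \<in> D. y d \<notin> O'})" using \<O>(3) d by blast
  qed
  moreover have "countable (\<Union>O'\<in>\<O>. {d \<in> D. y d \<notin> O'})"
    using \<O>(1) fin countable_finite by blast
  ultimately show ?thesis by (rule countable_subset)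
qed

lemma second_countable_dense_imp_quasi_G_delta_diagonal:
  assumes X: "compact_space X" "Hausdorff_space X"
    and H: "H \<subseteq> topspace X" "X closure_of H = topspace X" "second_countable (subtopology X H)"
    and Y: "Y = topspace X - H" and loc: "has_locally quasi_G_delta_diagonal (subtopology X Y)"
  shows "quasi_G_delta_diagonal X"
proof -
  have reg: "regular_space X" by (rule compact_Hausdorff_imp_regular_space[OF X])
  obtain \<B> where \<B>: "countable \<B>" "\<forall>V\<in>\<B>. openin (subtopology X H) V"
    "\<forall>U x. openin (subtopology X H) U \<and> x \<in> U \<longrightarrow> (\<exists>V\<in>\<B>. x \<in> V \<and> V \<subseteq> U)"
    using H(3) unfolding second_countable_def by blast
  have "\<forall>V\<in>\<B>. \<exists>T. openin X T \<and> V = T \<inter> H" using \<B>(2) by (auto simp: openin_subtopology)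
  from bchoice[OF this] obtain E where E: "\<forall>V\<in>\<B>. openin X (E V) \<and> V = E V \<inter> H" ..
  have base: "\<exists>V\<in>\<B>. x \<in> E V \<and> E V \<subseteq> X closure_of (E V) \<and> X closure_of (E V) \<subseteq> O'"
    if x: "x \<in> H" and O': "openin X O'" "x \<in> O'" for x O'
  proof -
    obtain U C where U: "openin X U" "closedin X C" "x \<in> U" "U \<subseteq> C" "C \<subseteq> O'"
      using regular_space_closed_neighbourhood[OF reg O'] by blast
    have "openin (subtopology X H) (U \<inter> H)" using U(1) by (auto simp: openin_subtopology)
    then obtain V where V: "V \<in> \<B>" "x \<in> V" "V \<subseteq> U \<inter> H" using \<B>(3) x U(3) by blast
    have opE: "openin X (E V)" using E V(1) by blast
    have "E V \<subseteq> C"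
    proof (rule ccontr)
      assume "\<not> E V \<subseteq> C"
      then obtain w where w: "w \<in> E V - C" by blast
      have "openin X (E V - C)" using opE U(2) by blast
      then obtain h where "h \<in> H" "h \<in> E V - C" using dense_meets_open[OF H(2) _ w] by blast
      then show False using E V(1,3) U(4) by blast
    qed
    then have "X closure_of (E V) \<subseteq> C" by (rule closure_of_minimal[OF _ U(2)])
    moreover have "E V \<subseteq> X closure_of (E V)" by (rule closure_of_subset[OF openin_subset[OF opE]])
    moreover have "x \<in> E V" using E V(1,2) by blast
    ultimately show ?thesis using V(1) U(5) by blast
  qed
  have lin: "Lindelof_space (subtopology X Y)"
    unfolding Lindelof_space_subtopology
  proof (intro allI impI)
    fix \<U> assume \<U>: "(\<forall>U\<in>\<U>. openin X U) \<and> topspace X \<inter> Y \<subseteq> \<Union>\<U>"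
    define K where "K = topspace X - \<Union>\<U>"
    have "closedin X K" unfolding K_def using \<U> by blast
    then have K: "compactin X K" by (rule closedin_compact_space[OF X(1)])
    have KH: "K \<subseteq> H" using \<U> Y unfolding K_def by blast
    define \<Z> where "\<Z> = {\<V>. finite \<V> \<and> \<V> \<subseteq> \<B> \<and> K \<subseteq> \<Union>(E ` \<V>)}"
    have "\<Z> \<subseteq> {\<V>. finite \<V> \<and> \<V> \<subseteq> \<B>}" unfolding \<Z>_def by blast
    then have cZ: "countable \<Z>" using countable_Collect_finite_subset[OF \<B>(1)] countable_subset by blast
    have "\<exists>\<W>. finite \<W> \<and> \<W> \<subseteq> \<U> \<and> topspace X - \<Union>(E ` \<V>) \<subseteq> \<Union>\<W>" if \<V>: "\<V> \<in> \<Z>" for \<V>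
    proof -
      have "openin X (\<Union>(E ` \<V>))" using \<V> E unfolding \<Z>_def by (intro openin_Union) blast
      then have "closedin X (topspace X - \<Union>(E ` \<V>))" by blast
      then have "compactin X (topspace X - \<Union>(E ` \<V>))" by (rule closedin_compact_space[OF X(1)])
      moreover have "topspace X - \<Union>(E ` \<V>) \<subseteq> \<Union>\<U>" using \<V> unfolding \<Z>_def K_def by blast
      ultimately show ?thesis using \<U> compactinD[of X _ \<U>] by blast
    qed
    then have "\<forall>\<V>\<in>\<Z>. \<exists>\<W>. finite \<W> \<and> \<W> \<subseteq> \<U> \<and> topspace X - \<Union>(E ` \<V>) \<subseteq> \<Union>\<W>" ..
    from bchoice[OF this] obtain \<W>
      where \<W>: "\<forall>\<V>\<in>\<Z>. finite (\<W> \<V>) \<and> \<W> \<V> \<subseteq> \<U> \<and> topspace X - \<Union>(E ` \<V>) \<subseteq> \<Union>(\<W> \<V>)" ..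
    show "\<exists>V. countable V \<and> V \<subseteq> \<U> \<and> topspace X \<inter> Y \<subseteq> \<Union>V"
    proof (intro exI[of _ "\<Union>\<V>\<in>\<Z>. \<W> \<V>"] conjI)
      show "countable (\<Union>\<V>\<in>\<Z>. \<W> \<V>)" using cZ \<W> countable_finite by blast
      show "(\<Union>\<V>\<in>\<Z>. \<W> \<V>) \<subseteq> \<U>" using \<W> by blast
      show "topspace X \<inter> Y \<subseteq> \<Union>(\<Union>\<V>\<in>\<Z>. \<W> \<V>)"
      proof
        fix y assume y: "y \<in> topspace X \<inter> Y"
        have opy: "openin X (topspace X - {y})" using X(2) y by (simp add: closedin_Hausdorff_singleton openin_diff)
        define \<O> where "\<O> = {V \<in> \<B>. y \<notin> E V}"
        have "K \<subseteq> \<Union>(E ` \<O>)"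
        proof
          fix x assume x: "x \<in> K"
          then have "x \<in> H" using KH by blast
          moreover have "x \<in> topspace X - {y}" using x \<U> y unfolding K_def by blast
          ultimately obtain V where "V \<in> \<B>" "x \<in> E V" "E V \<subseteq> topspace X - {y}"
            using base[OF _ opy] by blast
          then show "x \<in> \<Union>(E ` \<O>)" unfolding \<O>_def by blast
        qed
        moreover have "openin X U" if "U \<in> E ` \<O>" for U using that E unfolding \<O>_def by blast
        ultimately obtain \<P> where \<P>: "finite \<P>" "\<P> \<subseteq> E ` \<O>" "K \<subseteq> \<Union>\<P>"
          using compactinD[OF K, of "E ` \<O>"] by blast
        then obtain \<V> where \<V>: "\<V> \<subseteq> \<O>" "finite \<V>" "\<P> = E ` \<V>"
          using finite_subset_image[OF \<P>(1,2)] by blast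
        then have "\<V> \<in> \<Z>" using \<P>(3) unfolding \<Z>_def \<O>_def by blast
        moreover have "y \<in> topspace X - \<Union>(E ` \<V>)" using y \<V>(1) unfolding \<O>_def by blast
        moreover have "topspace X - \<Union>(E ` \<V>) \<subseteq> \<Union>(\<W> \<V>)" using \<W> \<open>\<V> \<in> \<Z>\<close> by simp
        ultimately show "y \<in> \<Union>(\<Union>\<V>\<in>\<Z>. \<W> \<V>)" by blast
      qed
    qed
  qed
  have topY: "topspace (subtopology X Y) = Y" using Y by auto
  have lin': "Lindelof_space (subtopology (subtopology X Y) Y)" using lin by (simp add: subtopology_subtopology)
  obtain \<AA> where \<AA>: "countable \<AA>" "\<And>\<G> U. \<lbrakk>\<G> \<in> \<AA>; U \<in> \<G>\<rbrakk> \<Longrightarrow> openin (subtopology X Y) U"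
    "\<And>x y. \<lbrakk>x \<in> Y; y \<in> Y; x \<noteq> y\<rbrakk> \<Longrightarrow> \<exists>\<G>\<in>\<AA>. x \<in> star x \<G> \<and> y \<notin> star x \<G>"
    by (rule has_locally_quasi_G_delta_diagonal_on_Lindelof[OF loc _ lin', unfolded topY]) auto
  define lift where "lift \<G> = {U. openin X U \<and> U \<inter> Y \<in> \<G>}" for \<G>
  define \<CC> where "\<CC> = lift ` \<AA> \<union> (\<lambda>V. {E V}) ` \<B> \<union> (\<lambda>V. {topspace X - X closure_of (E V)}) ` \<B>"
  show ?thesis
  proof (rule quasi_G_delta_diagonal_countable_families)
    show "countable \<CC>" unfolding \<CC>_def using \<AA>(1) \<B>(1) by simp
    show "openin X U" if "\<G> \<in> \<CC>" "U \<in> \<G>" for \<G> U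
      using that E unfolding \<CC>_def lift_def by auto
    fix x y assume xy: "x \<in> topspace X" "y \<in> topspace X" "x \<noteq> y"
    have opd: "openin X (topspace X - {w})" if "w \<in> topspace X" for w
      using X(2) that by (simp add: closedin_Hausdorff_singleton openin_diff)
    consider "x \<in> H" | "x \<in> Y" "y \<in> H" | "x \<in> Y" "y \<in> Y" using xy Y by blast
    then show "\<exists>\<G>\<in>\<CC>. x \<in> star x \<G> \<and> y \<notin> star x \<G>"
    proof cases
      case 1
      then obtain V where V: "V \<in> \<B>" "x \<in> E V" "E V \<subseteq> topspace X - {y}"
        using base[OF 1 opd[OF xy(2)]] xy by blast
      then have "x \<in> star x {E V} \<and> y \<notin> star x {E V}" by (auto simp: star_def)
      then show ?thesis using V(1) unfolding \<CC>_def by blast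
    next
      case 2
      then obtain V where V: "V \<in> \<B>" "y \<in> E V" "E V \<subseteq> X closure_of (E V)"
          "X closure_of (E V) \<subseteq> topspace X - {x}"
        using base[OF 2(2) opd[OF xy(1)]] xy by blast
      then have "x \<in> star x {topspace X - X closure_of (E V)} \<and> y \<notin> star x {topspace X - X closure_of (E V)}"
        using xy(1) by (auto simp: star_def)
      then show ?thesis using V(1) unfolding \<CC>_def by blast
    next
      case 3
      then obtain \<G> where \<G>: "\<G> \<in> \<AA>" "x \<in> star x \<G>" "y \<notin> star x \<G>" using \<AA>(3) xy(3) by blast
      obtain U where U: "U \<in> \<G>" "x \<in> U" using \<G>(2) by (auto simp: star_def)
      obtain T where T: "openin X T" "U = T \<inter> Y" using \<AA>(2)[OF \<G>(1) U(1)] by (auto simp: openin_subtopology)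
      have "x \<in> star x (lift \<G>)" using U T unfolding star_def lift_def by blast
      moreover have "y \<notin> star x (lift \<G>)" using \<G>(3) 3 unfolding star_def lift_def by blast
      ultimately show ?thesis using \<G>(1) unfolding \<CC>_def by blast
    qed
  qed
qed

section \<open>Rectifiable GO-spaces and their remainders\<close>

theorem theorem4p8:
  fixes G :: "'a topology" and bG Y :: "'b topology" and i :: "'a \<Rightarrow> 'b"
  assumes "Tychonoff_space G"
    and "GO_space TYPE('c::linorder_topology) G"
    and "rectifiable_space G"
    and "\<not> locally_compact_space G"
    and "Hausdorff_compactification G bG i"
    and "Y = subtopology bG (topspace bG - i ` topspace G)"
    and "has_locally quasi_G_delta_diagonal Y"
  shows "(separable_space G \<and> metrizable_space G) \<and>
         (separable_space Y \<and> metrizable_space Y) \<and>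
         (separable_space bG \<and> metrizable_space bG)"
proof -
  define H where "H = i ` topspace G"
  define X where "X = subtopology bG H"
  have bG: "compact_space bG" "Hausdorff_space bG" and emb: "embedding_map G bG i"
    and dH: "bG closure_of H = topspace bG"
    using assms(5) by (simp_all add: Hausdorff_compactification_def H_def)
  have "homeomorphic_map G X i" using emb by (simp add: embedding_map_def X_def H_def)
  then obtain j where ij: "homeomorphic_maps G X i j" using homeomorphic_map_maps by blast
  then have hom: "G homeomorphic_space X" unfolding homeomorphic_space_def by blast
  have HbG: "H \<subseteq> topspace bG"
    using embedding_map_imp_homeomorphic_space[OF emb] continuous_map_image_subset_topspace[of G bG i]
      emb embedding_map_def homeomorphic_imp_continuous_map continuous_map_in_subtopology
    unfolding H_def by metis
  then have topX: "topspace X = H" by (auto simp: X_def)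
  have GO: "GO_space TYPE('c) X"
    using assms(2) hom homeomorphic_space_sym homeomorphic_space_trans
    unfolding GO_space_def by metis
  obtain e0 p0 q0 where "rectification G e0 p0 q0"
    by (rule rectifiable_space_imp_rectification[OF assms(3)])
  then obtain e p q where rect: "rectification X e p q"
    using homeomorphic_rectification[OF ij] by blast
  have nlc: "\<not> locally_compact_space X"
    using assms(4) homeomorphic_locally_compact_space[OF hom] by blast
  define R where "R = topspace bG - H"
  have Y: "Y = subtopology bG R" using assms(6) by (simp add: R_def H_def)
  then have loc: "has_locally quasi_G_delta_diagonal (subtopology bG R)" using assms(7) by simp
  \<comment> \<open>An open subset of \<open>bG\<close> inside \<open>G\<close> would make \<open>G\<close> locally compact at one point, hence everywhere.\<close>
  have dR: "bG closure_of R = topspace bG"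
    unfolding dense_intersects_open
  proof (intro allI impI notI)
    fix T assume T: "openin bG T \<and> T \<noteq> {}" and "R \<inter> T = {}"
    then have TH: "T \<subseteq> H" using openin_subset unfolding R_def by blast
    obtain x where x: "x \<in> T" using T by blast
    have Top: "openin bG T" using T by blast
    obtain U C where U: "openin bG U" "closedin bG C" "x \<in> U" "U \<subseteq> C" "C \<subseteq> T"
      by (rule regular_space_closed_neighbourhood[OF compact_Hausdorff_imp_regular_space[OF bG] Top x])
    have "openin X (U \<inter> H)" using U(1) by (auto simp: X_def openin_subtopology)
    moreover have "U \<inter> H = U" using U(4,5) TH by blast
    moreover have "compactin X C"
      using closedin_compact_space[OF bG(1) U(2)] U(5) TH by (auto simp: X_def compactin_subtopology)
    ultimately show False
      using rect_locally_compact_if_somewhere[OF rect _ U(3,4)] nlc by simp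
  qed
  have "\<exists>x\<in>H. countable_pi_base_at X x"
  proof (rule ccontr)
    assume "\<not> ?thesis"
    then have P: "P_point (subtopology bG H) x" if "x \<in> H" for x
      using GO_space_P_point_or_pi_base[OF GO, of x] that topX by (auto simp: X_def)
    have "topspace bG \<noteq> {}" using rect_unit[OF rect] topX HbG by blast
    then show False
      using remainder_of_P_points_not_locally_quasi_G_delta_diagonal[OF bG _ HbG dH R_def dR P loc] by blast
  qed
  then obtain x where x: "x \<in> topspace X" "countable_pi_base_at X x" using topX by blast
  have sc: "second_countable X"
  proof (rule rect_second_countable[OF rect pi_base_imp_countable_base_at_unit[OF rect x]])
    fix D assume D: "D \<subseteq> topspace X"
      "\<And>x. x \<in> topspace X \<Longrightarrow> \<exists>U. openin X U \<and> x \<in> U \<and> (\<forall>d\<in>U \<inter> D. \<forall>d'\<in>U \<inter> D. d = d')"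
    have "\<exists>C. (\<forall>d\<in>D. openin X (C d) \<and> d \<in> C d) \<and>
      (\<forall>x\<in>topspace X. \<exists>U. openin X U \<and> x \<in> U \<and> finite {d \<in> D. C d \<inter> U \<noteq> {}})"
      by (rule GO_space_expand_discrete[OF GO D(1)]) (rule D(2))
    then obtain C where C: "\<forall>d\<in>D. openin X (C d) \<and> d \<in> C d"
      "\<forall>x\<in>topspace X. \<exists>U. openin X U \<and> x \<in> U \<and> finite {d \<in> D. C d \<inter> U \<noteq> {}}"
      by (elim exE conjE)
    show "countable D"
    proof (rule locally_finite_open_expansion_countable[OF bG HbG dH R_def dR loc])
      show "D \<subseteq> H" using D(1) topX by simp
      show "openin (subtopology bG H) (C d) \<and> d \<in> C d" if "d \<in> D" for d
        using bspec[OF C(1) that] by (simp add: X_def)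
      show "\<exists>U. openin (subtopology bG H) U \<and> x \<in> U \<and> finite {d \<in> D. C d \<inter> U \<noteq> {}}"
        if "x \<in> H" for x
        using bspec[OF C(2)[unfolded topX] that] by (simp add: X_def)
    qed
  qed
  have "quasi_G_delta_diagonal bG"
    using second_countable_dense_imp_quasi_G_delta_diagonal[OF bG HbG dH _ R_def loc] sc X_def by blast
  then have sm: "second_countable bG" "metrizable_space bG"
    using compact_quasi_G_delta_diagonal_imp_second_countable_metrizable[OF bG] by blast+
  have sub: "separable_space (subtopology bG S) \<and> metrizable_space (subtopology bG S)" for S
    using sm second_countable_imp_separable_space second_countable_subtopology metrizable_space_subtopology
    by blast
  have "separable_space G \<and> metrizable_space G"
    using sub[of H] homeomorphic_separable_space[OF hom] homeomorphic_metrizable_space[OF hom]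
    by (simp add: X_def)
  moreover have "separable_space Y \<and> metrizable_space Y" using sub[of R] by (simp add: Y)
  moreover have "separable_space bG \<and> metrizable_space bG" using sub[of "topspace bG"] by simp
  ultimately show ?thesis by blast
qed

end
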